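(* Let $\mathcal{X}_n=(\mathbf{X}_n^{(i)})_{i\in I}$ ($I\ne\emptyset$) be a family of independent unnormalized Wigner matrices with uniformly controlled moments and parameters $\beta_i\in\mathbb{C}$ (as defined in the context). Let $m\in\mathbb{N}$, $m\ge1$. For every test graph $T$ with labels in $I$, writing $N$ for the set of non-loop edges of $T$, $$\mathbb{E}\Big[\big|\mathrm{tr}[T(\mathcal{X}_n)]-\mathbb{E}\,\mathrm{tr}[T(\mathcal{X}_n)]\big|^{2m}\Big]=O_T\big(n^{m(\#(N)+1)}\big)\qquad(n\to\infty).$$ The bound is tight in the sense that there exist test graphs $T$ with labels in $I$ such that $$\mathbb{E}\Big[\big|\mathrm{tr}[T(\mathcal{X}_n)]-\mathbb{E}\,\mathrm{tr}[T(\mathcal{X}_n)]\big|^{2m}\Big]=\Theta_T\big(n^{m(\#(N)+1)}\big).$$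
   Context: Wigner matrices: for each $n$, $(\mathbf{X}_n^{(i)})_{i\in I}$ are random Hermitian $n\times n$ matrices such that the entries $(\mathbf{X}_n^{(i)}(j,k):1\le j\le k\le n,\ i\in I)$ are independent; diagonal entries are real-valued; for $j<k$, $\mathbb{E}\mathbf{X}_n^{(i)}(j,k)=0$, $\mathbb{E}|\mathbf{X}_n^{(i)}(j,k)|^2=1$, $\mathbb{E}[\mathbf{X}_n^{(i)}(j,k)^2]=\beta_i$; and for every finite $I_0\subset I$ and $\ell\in\mathbb{N}$, $\sup_n\sup_{i\in I_0}\sup_{1\le j\le k\le n}\mathbb{E}|\mathbf{X}_n^{(i)}(j,k)|^\ell<\infty$. A test graph $T=(V,E,\mathrm{src},\mathrm{tar},\gamma)$ with labels in $I$ is a finite, connected directed multigraph (loops and multiple edges allowed, $V\ne\emptyset$) with $\gamma:E\to I$. For such $T$, $$\mathrm{tr}[T(\mathcal{X}_n)]=\sum_{\phi:V\to[n]}\prod_{e\in E}\mathbf{X}_n^{(\gamma(e))}\big(\phi(\mathrm{tar}(e)),\phi(\mathrm{src}(e))\big).$$ Implicit constants in $O_T,\Theta_T$ do not depend on $n$ (they may depend on $T$, on the fixed $m$, and on the moment bounds). *)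

theory Defs
  imports
    "HOL-Probability.Probability"
    "HOL-Library.Landau_Symbols"
    "Jordan_Normal_Form.Schur_Decomposition"
    "Graph_Theory.Digraph_Component"
begin

text \<open>
  Rows and columns are numbered from 0, so the entry in position \<open>(j, k)\<close> with
  \<open>1 \<le> j \<le> k \<le> n\<close> is \<open>X n i \<omega> $$ (j - 1, k - 1)\<close>. The underlying probability space
  may change with \<open>n\<close>, and nothing is assumed about the joint law for different \<open>n\<close>.
\<close>

definition upper_indices :: "nat \<Rightarrow> (nat \<times> nat) set" where
  "upper_indices n = {(j, k). j \<le> k \<and> k < n}"

text \<open>
  The moment bound is stated with the nonnegative integral, so that it includes the
  existence of all moments; the Bochner integrals in the other assumptions are then
  genuine expectations. Diagonal entries need not be centred.
\<close>

locale wigner_family =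
  fixes M :: "nat \<Rightarrow> 'a measure"
    and I :: "'i set"
    and X :: "nat \<Rightarrow> 'i \<Rightarrow> 'a \<Rightarrow> complex mat"
    and \<beta> :: "'i \<Rightarrow> complex"
  assumes prob_spaces: "prob_space (M n)"
    and dims: "i \<in> I \<Longrightarrow> \<omega> \<in> space (M n) \<Longrightarrow> X n i \<omega> \<in> carrier_mat n n"
    and hermitian: "i \<in> I \<Longrightarrow> \<omega> \<in> space (M n) \<Longrightarrow> mat_adjoint (X n i \<omega>) = X n i \<omega>"
    and real_diagonal:
      "i \<in> I \<Longrightarrow> \<omega> \<in> space (M n) \<Longrightarrow> j < n \<Longrightarrow> X n i \<omega> $$ (j, j) \<in> \<real>"
    and independent:
      "prob_space.indep_vars (M n) (\<lambda>_. borel) (\<lambda>(i, jk) \<omega>. X n i \<omega> $$ jk)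
         (I \<times> upper_indices n)"
    and mean_zero:
      "i \<in> I \<Longrightarrow> j < k \<Longrightarrow> k < n \<Longrightarrow> (\<integral>\<omega>. X n i \<omega> $$ (j, k) \<partial>M n) = 0"
    and variance_one:
      "i \<in> I \<Longrightarrow> j < k \<Longrightarrow> k < n \<Longrightarrow> (\<integral>\<omega>. (cmod (X n i \<omega> $$ (j, k)))\<^sup>2 \<partial>M n) = 1"
    and pseudo_variance:
      "i \<in> I \<Longrightarrow> j < k \<Longrightarrow> k < n \<Longrightarrow> (\<integral>\<omega>. (X n i \<omega> $$ (j, k))\<^sup>2 \<partial>M n) = \<beta> i"
    and moments:
      "finite I0 \<Longrightarrow> I0 \<subseteq> I \<Longrightarrow>
         (SUP n. SUP i\<in>I0. SUP jk\<in>upper_indices n.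
            \<integral>\<^sup>+\<omega>. ennreal (cmod (X n i \<omega> $$ jk) ^ l) \<partial>M n) < \<infinity>"

text \<open>
  Loops and multiple arcs are allowed by \<^locale>\<open>fin_digraph\<close>; connectedness is that of the
  underlying undirected graph and includes nonemptiness of the vertex set. The name has
  to be qualified because it is also used for topological connectedness.
\<close>

locale test_graph = fin_digraph G
  for I :: "'i set" and G :: "('v, 'e) pre_digraph" and \<gamma> :: "'e \<Rightarrow> 'i" +
  assumes conn: "Digraph_Component.connected G"
    and labels: "\<And>e. e \<in> arcs G \<Longrightarrow> \<gamma> e \<in> I"

definition graph_trace ::
    "nat \<Rightarrow> ('v, 'e) pre_digraph \<Rightarrow> ('e \<Rightarrow> 'i) \<Rightarrow> ('i \<Rightarrow> complex mat) \<Rightarrow> complex" where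
  "graph_trace n G \<gamma> A =
     (\<Sum>\<phi> \<in> verts G \<rightarrow>\<^sub>E {..<n}. \<Prod>e\<in>arcs G. A (\<gamma> e) $$ (\<phi> (head G e), \<phi> (tail G e)))"

definition non_loops :: "('v, 'e) pre_digraph \<Rightarrow> 'e set" where
  "non_loops G = {e \<in> arcs G. tail G e \<noteq> head G e}"

definition central_moment :: "'a measure \<Rightarrow> ('a \<Rightarrow> complex) \<Rightarrow> nat \<Rightarrow> real" where
  "central_moment P Y p = (\<integral>\<omega>. cmod (Y \<omega> - (\<integral>\<omega>'. Y \<omega>' \<partial>P)) ^ p \<partial>P)"

end

theory Submission
  imports Defs
begin

text \<open>
  Expand the \<open>2 m\<close>-th central moment over \<open>2 m\<close>-tuples of vertex maps. By independence and
  centredness a tuple contributes only if every off-diagonal matrix entry that occurs in it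
  occurs at least twice, and every map of the tuple shares a vertex with another one. The
  union of the images is then a graph with at most \<open>m\<close> components and at most \<open>m #(N)\<close> edges,
  hence with at most \<open>m (#(N) + 1)\<close> vertices, and each contribution is bounded by the
  moment assumptions.

  For the lower bound take two arcs from distinct leaves into a common centre. The terms of
  injective vertex maps have pairwise covariances 0 or 1 and are orthogonal to
  all others, so the variance is at least the number of injective maps, of order \<open>n\<^sup>3\<close>,
  whatever \<open>\<beta>\<close> is; Jensen's inequality gives the higher moments. A single arc would not do:
  for \<open>\<beta> = -1\<close> the two orientations of an entry cancel.
\<close>

subsection \<open>Counting vertex maps\<close>

text \<open>Ore's theorem: the complement of a minimal dominating set is dominating as well.\<close>

lemma half_dominating_set:
  assumes fin: "finite J"
    and nbr: "\<And>j. j \<in> J \<Longrightarrow> \<exists>k\<in>J. k \<noteq> j \<and> s j k"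
    and sym: "\<And>j k. s j k \<Longrightarrow> s k j"
  obtains D where "D \<subseteq> J" "2 * card D \<le> card J" "\<And>j. j \<in> J - D \<Longrightarrow> \<exists>k\<in>D. s j k"
proof -
  define P where "P D \<longleftrightarrow> D \<subseteq> J \<and> (\<forall>j\<in>J - D. \<exists>k\<in>D. s j k)" for D
  have "P J" by (auto simp: P_def)
  then obtain D where D: "P D" "\<And>D'. P D' \<Longrightarrow> card D \<le> card D'"
    using ex_has_least_nat[of P J card] by blast
  have DJ: "D \<subseteq> J" using D(1) by (auto simp: P_def)
  have finD: "finite D" using DJ fin by (rule finite_subset)
  have "\<exists>k\<in>J - D. s j k" if j: "j \<in> D" for j
  proof (rule ccontr)
    assume none: "\<not> (\<exists>k\<in>J - D. s j k)"
    \<comment> \<open>Without a neighbour outside \<open>D\<close>, \<open>j\<close> would be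
      redundant: its own neighbour lies in \<open>D\<close>, and no vertex outside \<open>D\<close>
      relies on \<open>j\<close>. This would contradict minimality.\<close>
    have "\<exists>k\<in>D - {j}. s i k" if i: "i \<in> J - (D - {j})" for i
    proof (cases "i = j")
      case True
      then show ?thesis using nbr[of j] none j DJ by blast
    next
      case False
      then obtain k where "k \<in> D" "s i k" using D(1) i by (auto simp: P_def)
      then show ?thesis using none sym False i by blast
    qed
    then have "P (D - {j})" using DJ by (auto simp: P_def)
    then have "card D \<le> card (D - {j})" by (rule D(2))
    then show False using finD j by (metis card_Diff1_less leD)
  qed
  then have "P (J - D)" using DJ by (auto simp: P_def)
  then have "card D \<le> card (J - D)" by (rule D(2))
  then have "2 * card D \<le> card J"
    using fin DJ finD by (simp add: card_Diff_subset card_mono)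
  with DJ D(1) show thesis by (intro that) (auto simp: P_def)
qed

text \<open>The relation of having the same value under \<open>f\<close> leaves no point isolated,
  so a dominating set of half the size already meets every fibre of \<open>f\<close>.\<close>

lemma card_image_le_half:
  assumes fin: "finite A" and twice: "\<And>a. a \<in> A \<Longrightarrow> \<exists>b\<in>A. b \<noteq> a \<and> f b = f a"
  shows "2 * card (f ` A) \<le> card A"
proof -
  obtain D where D: "D \<subseteq> A" "2 * card D \<le> card A" "\<And>a. a \<in> A - D \<Longrightarrow> \<exists>b\<in>D. f b = f a"
    using half_dominating_set[of A "\<lambda>a b. f b = f a"] fin twice by metis
  have "f ` A \<subseteq> f ` D"
  proof
    fix y assume "y \<in> f ` A"
    then obtain a where a: "a \<in> A" "y = f a" by blast
    show "y \<in> f ` D"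
    proof (cases "a \<in> D")
      case False
      then obtain b where "b \<in> D" "f b = f a" using D(3)[of a] a by blast
      then show ?thesis using a by (metis imageI)
    qed (use a in blast)
  qed
  then have "card (f ` A) \<le> card D"
    using D(1) fin by (meson card_image_le card_mono finite_imageI finite_subset le_trans)
  then show ?thesis using D(2) by simp
qed

text \<open>The size bound for a spanning forest: \<open>cut\<close> says that everything in
  \<open>W\<close> can be reached from \<open>R\<close> along \<open>F\<close>, and each vertex
  outside \<open>R\<close> uses up one edge when it is first reached.\<close>

lemma card_vertices_le_edges_plus_roots:
  assumes "finite W" "finite F" "R \<subseteq> W"
    and cut: "\<And>S. R \<subseteq> S \<Longrightarrow> S \<subset> W \<Longrightarrow> \<exists>a\<in>S. \<exists>b\<in>W - S. {a, b} \<in> F"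
  shows "card W \<le> card F + card R"
  using assms
proof (induction "card (W - R)" arbitrary: R F)
  case 0
  then show ?case by (simp add: card_mono)
next
  case (Suc k)
  have "R \<subset> W" using Suc.hyps(2) Suc.prems(3) by auto
  then obtain a b where ab: "a \<in> R" "b \<in> W - R" "{a, b} \<in> F"
    using Suc.prems(4)[of R] by blast
  have finR: "finite R" using Suc.prems by (meson finite_subset)
  \<comment> \<open>Once \<open>b\<close> has joined the roots, \<open>{a, b}\<close> lies inside
    every \<open>S\<close> under consideration, so it can be deleted without harming the cut
    condition.\<close>
  have "\<exists>c\<in>S. \<exists>d\<in>W - S. {c, d} \<in> F - {{a, b}}" if S: "insert b R \<subseteq> S" "S \<subset> W" for S
  proof -
    obtain c d where "c \<in> S" "d \<in> W - S" "{c, d} \<in> F" using Suc.prems(4)[of S] S by blast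
    moreover have "{c, d} \<noteq> {a, b}" using S ab \<open>d \<in> W - S\<close> by (auto simp: doubleton_eq_iff)
    ultimately show ?thesis by blast
  qed
  moreover have "k = card (W - insert b R)"
    using Suc.hyps(2) ab Suc.prems(1) by (simp add: Diff_insert[of W b R])
  ultimately have "card W \<le> card (F - {{a, b}}) + card (insert b R)"
    using ab Suc.prems(1-3) by (intro Suc.hyps(1)) simp_all
  moreover have "card F > 0" using ab Suc.prems(2) by (auto simp: card_gt_0_iff)
  ultimately show ?case using ab finR Suc.prems(2) by simp
qed

text \<open>A function with at most \<open>K\<close> values factors through \<open>{..<K}\<close>,
  so it suffices to count pairs of maps. The count is generous, but its order in \<open>n\<close> is
  \<open>n ^ K\<close>, which is what matters.\<close>

lemma card_functions_small_image:
  assumes fin: "finite D" and ne: "D \<noteq> {}"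
  shows "card {f \<in> D \<rightarrow>\<^sub>E {..<n}. card (f ` D) \<le> K} \<le> K ^ card D * n ^ K"
proof -
  let ?H = "(D \<rightarrow>\<^sub>E {..<K}) \<times> ({..<K} \<rightarrow>\<^sub>E {..<n})"
  have "\<exists>h\<in>?H. f = restrict (snd h \<circ> fst h) D"
    if f: "f \<in> D \<rightarrow>\<^sub>E {..<n}" "card (f ` D) \<le> K" for f :: "'a \<Rightarrow> nat"
  proof -
    obtain g where g: "inj_on g (f ` D)" "g ` f ` D \<subseteq> {..<K}"
      using fin f(2) by (metis card_lessThan finite_imageI finite_lessThan card_le_inj)
    define h1 where "h1 = restrict (g \<circ> f) D"
    obtain d where d: "d \<in> D" using ne by blast
    \<comment> \<open>Numbers that \<open>g\<close> does not reach get the default value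
      \<open>f d\<close>, which is below \<open>n\<close>; here \<open>D\<close> has to be
      nonempty.\<close>
    define h2 where "h2 = restrict (\<lambda>k. if k \<in> g ` f ` D then inv_into (f ` D) g k else f d) {..<K}"
    have h1: "h1 \<in> D \<rightarrow>\<^sub>E {..<K}" using g(2) by (auto simp: h1_def image_subset_iff)
    have h2: "h2 \<in> {..<K} \<rightarrow>\<^sub>E {..<n}"
    proof -
      have "inv_into (f ` D) g k \<in> {..<n}" if "k \<in> g ` f ` D" for k
        using inv_into_into[OF that] f(1) by (auto dest: PiE_mem)
      moreover have "f d \<in> {..<n}" using f(1) d by (rule PiE_mem)
      ultimately show ?thesis unfolding h2_def by (simp add: PiE_iff)
    qed
    have "f = restrict (h2 \<circ> h1) D"
    proof
      fix x show "f x = restrict (h2 \<circ> h1) D x"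
      proof (cases "x \<in> D")
        case True
        then have "g (f x) \<in> g ` f ` D" "g (f x) \<in> {..<K}" using g(2) by blast+
        then show ?thesis using True g(1) by (simp add: h1_def h2_def)
      next
        case False
        then show ?thesis using PiE_arb[OF f(1)] by simp
      qed
    qed
    then have "f = restrict (snd (h1, h2) \<circ> fst (h1, h2)) D" by (simp only: fst_conv snd_conv)
    then show ?thesis using h1 h2 by blast
  qed
  then have "{f \<in> D \<rightarrow>\<^sub>E {..<n}. card (f ` D) \<le> K} \<subseteq> (\<lambda>h. restrict (snd h \<circ> fst h) D) ` ?H"
    by blast
  then have "card {f \<in> D \<rightarrow>\<^sub>E {..<n}. card (f ` D) \<le> K} \<le> card ((\<lambda>h. restrict (snd h \<circ> fst h) D) ` ?H)"
    using fin by (intro card_mono) (auto intro!: finite_PiE)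
  also have "\<dots> \<le> card ?H" using fin by (intro card_image_le) (auto intro!: finite_PiE)
  also have "\<dots> = K ^ card D * n ^ K" using fin by (simp add: card_cartesian_product card_PiE)
  finally show ?thesis .
qed

lemma (in test_graph) verts_nonempty: "verts G \<noteq> {}"
  using conn by (auto simp: connected_def strongly_connected_def)

text \<open>If no arc crossed the boundary of \<open>S\<close>, then every walk in the symmetrised
  graph that starts in \<open>S\<close> would stay there, in particular one from \<open>u\<close> to
  \<open>w\<close>.\<close>

lemma (in test_graph) crossing_arc:
  assumes "u \<in> verts G" "u \<in> S" "w \<in> verts G" "w \<notin> S"
  shows "\<exists>e\<in>arcs G. (head G e \<in> S) \<noteq> (tail G e \<in> S)"
proof (rule ccontr)
  assume none: "\<not> ?thesis"
  have "u \<rightarrow>\<^sup>*\<^bsub>with_proj (mk_symmetric G)\<^esub> w"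
    using conn assms by (auto simp: connected_def strongly_connected_def)
  then have "(u, w) \<in> rtrancl_on (verts G) (parcs (mk_symmetric G))"
    by (simp add: reachable_def)
  then have "w \<in> S"
    by (induction rule: rtrancl_on_induct) (use none assms in \<open>auto simp: parcs_mk_symmetric\<close>)
  then show False using assms by simp
qed

text \<open>
  Half of the maps suffice to meet all components of the union, and half of the pairs of a map
  and a non-loop suffice to represent all its edges.
\<close>

lemma (in test_graph) card_union_images:
  fixes \<phi> :: "'j \<Rightarrow> 'v \<Rightarrow> 'w"
  assumes J: "finite J"
    and twice: "\<And>j e. j \<in> J \<Longrightarrow> e \<in> arcs G \<Longrightarrow> \<phi> j (head G e) \<noteq> \<phi> j (tail G e) \<Longrightarrow>
      \<exists>k\<in>J. \<exists>f\<in>arcs G. (k, f) \<noteq> (j, e) \<and>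
        {\<phi> k (head G f), \<phi> k (tail G f)} = {\<phi> j (head G e), \<phi> j (tail G e)}"
    and meet: "\<And>j. j \<in> J \<Longrightarrow> \<exists>k\<in>J. k \<noteq> j \<and> \<phi> j ` verts G \<inter> \<phi> k ` verts G \<noteq> {}"
  shows "2 * card (\<Union>j\<in>J. \<phi> j ` verts G) \<le> card J * (card (non_loops G) + 1)"
proof -
  define W where "W = (\<Union>j\<in>J. \<phi> j ` verts G)"
  have finW: "finite W" using J by (auto simp: W_def)
  \<comment> \<open>The pairs of a map and an arc whose image is a genuine edge. By
    \<open>twice\<close>, each fibre of \<open>en\<close> on \<open>A\<close> has at least two
    elements.\<close>
  define A where "A = {(j, e) \<in> J \<times> arcs G. \<phi> j (head G e) \<noteq> \<phi> j (tail G e)}"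
  define en where "en = (\<lambda>(j, e). {\<phi> j (head G e), \<phi> j (tail G e)})"
  have A_sub: "A \<subseteq> J \<times> non_loops G" by (auto simp: A_def non_loops_def)
  have fin_nl: "finite (non_loops G)" by (auto simp: non_loops_def)
  have finA: "finite A" using A_sub J fin_nl by (meson finite_SigmaI finite_subset)
  have "\<exists>b\<in>A. b \<noteq> a \<and> en b = en a" if a: "a \<in> A" for a
  proof -
    obtain j e where je: "a = (j, e)" "j \<in> J" "e \<in> arcs G" "\<phi> j (head G e) \<noteq> \<phi> j (tail G e)"
      using a by (auto simp: A_def)
    from twice[OF je(2-4)] obtain k f where kf: "k \<in> J" "f \<in> arcs G" "(k, f) \<noteq> (j, e)"
      "{\<phi> k (head G f), \<phi> k (tail G f)} = {\<phi> j (head G e), \<phi> j (tail G e)}" by blast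
    then have "\<phi> k (head G f) \<noteq> \<phi> k (tail G f)" using je(4) by (auto simp: doubleton_eq_iff)
    then show ?thesis using kf je by (intro bexI[of _ "(k, f)"]) (auto simp: A_def en_def)
  qed
  then have "2 * card (en ` A) \<le> card A" by (rule card_image_le_half[OF finA])
  also have "\<dots> \<le> card (J \<times> non_loops G)" using A_sub J fin_nl by (intro card_mono) auto
  finally have edges: "2 * card (en ` A) \<le> card J * card (non_loops G)"
    by (simp add: card_cartesian_product)
  obtain D where D: "D \<subseteq> J" "2 * card D \<le> card J"
    "\<And>j. j \<in> J - D \<Longrightarrow> \<exists>k\<in>D. \<phi> j ` verts G \<inter> \<phi> k ` verts G \<noteq> {}"
  proof (rule half_dominating_set[of J "\<lambda>j k. \<phi> j ` verts G \<inter> \<phi> k ` verts G \<noteq> {}"])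
    show "\<phi> k ` verts G \<inter> \<phi> j ` verts G \<noteq> {}" if "\<phi> j ` verts G \<inter> \<phi> k ` verts G \<noteq> {}" for j k
      using that by (simp add: Int_commute)
  qed (use J meet in auto)
  obtain v0 where v0: "v0 \<in> verts G" using verts_nonempty by blast
  \<comment> \<open>One root for each map in the dominating set \<open>D\<close>; the image of the
    rest of its graph is reached along edges.\<close>
  define R where "R = (\<lambda>j. \<phi> j v0) ` D"
  have "\<exists>a\<in>S. \<exists>b\<in>W - S. {a, b} \<in> en ` A" if S: "R \<subseteq> S" "S \<subset> W" for S
  proof (rule ccontr)
    assume none: "\<not> ?thesis"
    \<comment> \<open>As no edge leads from \<open>S\<close> to \<open>W - S\<close> and the test
      graph is connected, an image that meets \<open>S\<close> lies in \<open>S\<close>. This first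
      absorbs the images of the maps in \<open>D\<close>, then all images that meet one of
      those.\<close>
    have absorb: "\<phi> j ` verts G \<subseteq> S" if j: "j \<in> J" and u: "u \<in> verts G" "\<phi> j u \<in> S" for j u
    proof (rule ccontr)
      assume "\<not> \<phi> j ` verts G \<subseteq> S"
      then obtain w where "w \<in> verts G" "\<phi> j w \<notin> S" by blast
      then obtain e where e: "e \<in> arcs G" "(\<phi> j (head G e) \<in> S) \<noteq> (\<phi> j (tail G e) \<in> S)"
        using crossing_arc[of u "{v. \<phi> j v \<in> S}" w] u by auto
      then have "(j, e) \<in> A" using j by (auto simp: A_def)
      then have "{\<phi> j (head G e), \<phi> j (tail G e)} \<in> en ` A" by (force simp: en_def)
      moreover have "\<phi> j (head G e) \<in> W" "\<phi> j (tail G e) \<in> W" using j e head_in_verts tail_in_verts unfolding W_def by blast+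
      ultimately show False using none e(2) by (metis DiffI insert_commute)
    qed
    have "\<phi> j ` verts G \<subseteq> S" if "j \<in> D" for j
      using absorb[of j v0] that D(1) S(1) v0 by (auto simp: R_def)
    moreover have "\<phi> j ` verts G \<subseteq> S" if "j \<in> J - D" for j
      using D(3)[OF that] calculation absorb[of j] that by blast
    ultimately have "W \<subseteq> S" by (auto simp: W_def)
    then show False using S(2) by blast
  qed
  then have "card W \<le> card (en ` A) + card R"
    using finW finA D(1) v0 by (intro card_vertices_le_edges_plus_roots) (auto simp: R_def W_def)
  moreover have "card R \<le> card D" using D(1) J by (auto simp: R_def intro: card_image_le finite_subset)
  ultimately show ?thesis using edges D(2) by (simp add: W_def)
qed

subsection \<open>Monomials in independent variables\<close>

text \<open>A conjugation controlled by a flag handles both sources of conjugates uniformly: the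
  matrix entries below the diagonal and the factors \<open>cnj z\<close> in an even power of
  \<open>cmod z\<close>. Composition is exclusive or of the flags.\<close>

definition twist :: "bool \<Rightarrow> complex \<Rightarrow> complex" where
  "twist s z = (if s then cnj z else z)"

lemma norm_twist [simp]: "norm (twist s z) = norm z"
  by (simp add: twist_def)

lemma twist_measurable [measurable]: "twist s \<in> borel_measurable borel"
  unfolding twist_def by (cases s) (auto intro!: borel_measurable_continuous_onI continuous_intros)

lemma twist_0 [simp]: "twist s 0 = 0"
  and twist_diff: "twist s (x - y) = twist s x - twist s y"
  and twist_twist: "twist s (twist t x) = twist (s \<noteq> t) x"
  by (auto simp: twist_def)

lemma twist_prod: "twist s (\<Prod>k\<in>K. f k) = (\<Prod>k\<in>K. twist s (f k))"
  and twist_sum: "twist s (\<Sum>k\<in>K. f k) = (\<Sum>k\<in>K. twist s (f k))"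
  by (auto simp: twist_def)

lemma twist_integral: "twist s (\<integral>\<omega>. f \<omega> \<partial>M) = (\<integral>\<omega>. twist s (f \<omega>) \<partial>M)"
  by (auto simp: twist_def)

text \<open>An elementary substitute for the inequality of Hoelder: either all factors are at most
  1, or the largest one exceeds 1 and its power bounds the product.\<close>

lemma prod_le_one_plus_sum_power:
  fixes x :: "'k \<Rightarrow> real"
  assumes "finite K" "card K \<le> L" "\<And>k. k \<in> K \<Longrightarrow> 0 \<le> x k"
  shows "(\<Prod>k\<in>K. x k) \<le> 1 + (\<Sum>k\<in>K. x k ^ L)"
proof (cases "\<forall>k\<in>K. x k \<le> 1")
  case True
  then have "(\<Prod>k\<in>K. x k) \<le> 1" using assms by (intro prod_le_1) auto
  moreover have "0 \<le> (\<Sum>k\<in>K. x k ^ L)" using assms by (intro sum_nonneg) auto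
  ultimately show ?thesis by simp
next
  case False
  define y where "y = Max (x ` K)"
  have ne: "K \<noteq> {}" using False by auto
  have "y \<in> x ` K" unfolding y_def using assms ne by (intro Max_in) auto
  then obtain k where k: "k \<in> K" "y = x k" by blast
  have le: "x i \<le> y" if "i \<in> K" for i using that assms by (auto simp: y_def)
  have y1: "1 \<le> y" using False le by force
  have "(\<Prod>k\<in>K. x k) \<le> (\<Prod>k\<in>K. y)" using assms le by (intro prod_mono) auto
  also have "\<dots> = y ^ card K" by simp
  also have "\<dots> \<le> y ^ L" using y1 assms by (intro power_increasing) auto
  also have "\<dots> \<le> (\<Sum>k\<in>K. x k ^ L)" unfolding k(2) using assms k
    by (intro member_le_sum) auto
  finally show ?thesis by simp
qed

locale moment_family = prob_space M for M :: "'a measure" +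
  fixes U :: "'w \<Rightarrow> 'a \<Rightarrow> complex" and A :: "'w set"
  assumes indep: "indep_vars (\<lambda>_. borel) U A"
    and moments: "w \<in> A \<Longrightarrow> integrable M (\<lambda>\<omega>. cmod (U w \<omega>) ^ l)"
begin

text \<open>Factors are indexed by \<open>K\<close> and not by the variables themselves, so that a
  variable may occur several times, both with and without conjugation.\<close>

definition monomial :: "'k set \<Rightarrow> ('k \<Rightarrow> 'w) \<Rightarrow> ('k \<Rightarrow> bool) \<Rightarrow> 'a \<Rightarrow> complex" where
  "monomial K v s \<omega> = (\<Prod>k\<in>K. twist (s k) (U (v k) \<omega>))"

lemma U_measurable [measurable]: "w \<in> A \<Longrightarrow> U w \<in> borel_measurable M"
  using indep by (auto simp: indep_vars_def)

lemma monomial_measurable: "v ` K \<subseteq> A \<Longrightarrow> monomial K v s \<in> borel_measurable M"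
  unfolding monomial_def by measurable blast

lemma norm_monomial: "norm (monomial K v s \<omega>) = (\<Prod>k\<in>K. cmod (U (v k) \<omega>))"
  by (simp add: monomial_def prod_norm[symmetric])

lemma monomial_integrable:
  assumes "finite K" "v ` K \<subseteq> A"
  shows "integrable M (monomial K v s)"
proof (rule Bochner_Integration.integrable_bound)
  show "integrable M (\<lambda>\<omega>. 1 + (\<Sum>k\<in>K. cmod (U (v k) \<omega>) ^ card K))"
    using assms moments by (intro Bochner_Integration.integrable_add Bochner_Integration.integrable_sum) auto
  show "AE \<omega> in M. norm (monomial K v s \<omega>) \<le> norm (1 + (\<Sum>k\<in>K. cmod (U (v k) \<omega>) ^ card K))"
  proof (rule AE_I2)
    fix \<omega>
    have "norm (monomial K v s \<omega>) \<le> 1 + (\<Sum>k\<in>K. cmod (U (v k) \<omega>) ^ card K)"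
      unfolding norm_monomial using assms by (intro prod_le_one_plus_sum_power) auto
    then show "norm (monomial K v s \<omega>) \<le> norm (1 + (\<Sum>k\<in>K. cmod (U (v k) \<omega>) ^ card K))"
      by (simp add: abs_le_iff)
  qed
qed (use assms monomial_measurable in auto)

text \<open>Only absolute moments of the one order \<open>L\<close> enter, so the same bound serves
  all monomials with at most \<open>L\<close> factors.\<close>

lemma norm_expectation_monomial_le:
  assumes "finite K" "v ` K \<subseteq> A" "card K \<le> L" "0 \<le> C"
    and C: "\<And>k. k \<in> K \<Longrightarrow> expectation (\<lambda>\<omega>. cmod (U (v k) \<omega>) ^ L) \<le> C"
  shows "cmod (expectation (monomial K v s)) \<le> 1 + real L * C"
proof -
  have int: "integrable M (\<lambda>\<omega>. cmod (U (v k) \<omega>) ^ L)" if "k \<in> K" for k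
    using that assms moments by auto
  have "cmod (expectation (monomial K v s)) \<le> expectation (\<lambda>\<omega>. cmod (monomial K v s \<omega>))"
    by (rule integral_norm_bound)
  also have "\<dots> \<le> expectation (\<lambda>\<omega>. 1 + (\<Sum>k\<in>K. cmod (U (v k) \<omega>) ^ L))"
    using assms int monomial_integrable
    by (intro integral_mono prod_le_one_plus_sum_power integrable_norm
        Bochner_Integration.integrable_add Bochner_Integration.integrable_sum)
      (auto simp: norm_monomial intro: prod_le_one_plus_sum_power)
  also have "\<dots> = 1 + (\<Sum>k\<in>K. expectation (\<lambda>\<omega>. cmod (U (v k) \<omega>) ^ L))"
    using int by (subst Bochner_Integration.integral_add) (auto simp: Bochner_Integration.integral_sum prob_space)
  also have "(\<Sum>k\<in>K. expectation (\<lambda>\<omega>. cmod (U (v k) \<omega>) ^ L)) \<le> real (card K) * C"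
    using C by (rule sum_bounded_above)
  also have "real (card K) * C \<le> real L * C" using assms by (intro mult_right_mono) auto
  finally show ?thesis by simp
qed

text \<open>Grouping the factors by variable leaves a product of functions of distinct, hence
  independent, variables.\<close>

lemma expectation_monomial:
  assumes K: "finite K" "v ` K \<subseteq> A"
  shows "expectation (monomial K v s)
    = (\<Prod>w\<in>v ` K. expectation (monomial {k \<in> K. v k = w} v s))"
proof -
  \<comment> \<open>This form shows each group as a function of \<open>U w\<close> alone, as
    \<open>indep_vars_compose2\<close> requires.\<close>
  have fibre: "monomial {k \<in> K. v k = w} v s \<omega> = (\<Prod>k | k \<in> K \<and> v k = w. twist (s k) (U w \<omega>))" for w \<omega>
    unfolding monomial_def by (intro prod.cong) auto
  have "monomial K v s \<omega> = (\<Prod>w\<in>v ` K. monomial {k \<in> K. v k = w} v s \<omega>)" for \<omega>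
    unfolding monomial_def using K by (intro prod.image_gen) auto
  then have "expectation (monomial K v s)
      = expectation (\<lambda>\<omega>. \<Prod>w\<in>v ` K. monomial {k \<in> K. v k = w} v s \<omega>)"
    by (intro Bochner_Integration.integral_cong) auto
  moreover have "indep_vars (\<lambda>_. borel) (\<lambda>w \<omega>. monomial {k \<in> K. v k = w} v s \<omega>) (v ` K)"
    unfolding fibre
    by (rule indep_vars_compose2[OF indep_vars_subset[OF indep K(2)]]) measurable
  moreover have "integrable M (monomial {k \<in> K. v k = w} v s)" for w
    using K by (intro monomial_integrable) auto
  ultimately show ?thesis using K(1) by (simp add: indep_vars_lebesgue_integral)
qed

lemma expectation_monomial_Un:
  assumes "finite K" "finite L" "v ` (K \<union> L) \<subseteq> A" "v ` K \<inter> v ` L = {}"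
  shows "expectation (monomial (K \<union> L) v s) = expectation (monomial K v s) * expectation (monomial L v s)"
proof -
  have "{k \<in> K \<union> L. v k = w} = {k \<in> K. v k = w}" if "w \<in> v ` K" for w
    using that assms(4) by auto
  moreover have "{k \<in> K \<union> L. v k = w} = {k \<in> L. v k = w}" if "w \<in> v ` L" for w
    using that assms(4) by auto
  ultimately show ?thesis
    using assms by (simp add: expectation_monomial[of "K \<union> L"] expectation_monomial[of K]
        expectation_monomial[of L] image_Un prod.union_disjoint)
qed

text \<open>The group of the variable \<open>v k\<close> is the single factor \<open>k\<close>, so
  its expectation is that of a centred variable, possibly conjugated.\<close>

lemma expectation_monomial_eq_0:
  assumes K: "finite K" "v ` K \<subseteq> A" and k: "k \<in> K"
    and single: "\<And>i. i \<in> K \<Longrightarrow> i \<noteq> k \<Longrightarrow> v i \<noteq> v k"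
    and centred: "expectation (U (v k)) = 0"
  shows "expectation (monomial K v s) = 0"
proof -
  have "{i \<in> K. v i = v k} = {k}" using k single by auto
  then have "expectation (monomial {i \<in> K. v i = v k} v s) = expectation (\<lambda>\<omega>. twist (s k) (U (v k) \<omega>))"
    by (simp add: monomial_def[abs_def])
  also have "\<dots> = 0" using centred by (simp add: twist_integral[symmetric])
  finally show ?thesis using K k by (auto simp: expectation_monomial intro!: prod_zero)
qed

section \<open>Products of centred blocks\<close>

definition centred :: "('k set) \<Rightarrow> ('k \<Rightarrow> 'w) \<Rightarrow> ('k \<Rightarrow> bool) \<Rightarrow> 'a \<Rightarrow> complex" where
  "centred K v s \<omega> = monomial K v s \<omega> - expectation (monomial K v s)"

lemma prod_monomial_blocks:
  "(\<Prod>j\<in>S. monomial ({j} \<times> E) v s \<omega>) = monomial (S \<times> E) v s \<omega>"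
  by (simp add: monomial_def prod.cartesian_product' )

lemma prod_centred_expand:
  assumes "finite J"
  shows "(\<Prod>j\<in>J. centred ({j} \<times> E) v s \<omega>) =
    (\<Sum>S\<in>Pow J. (\<Prod>j\<in>J - S. - expectation (monomial ({j} \<times> E) v s)) * monomial (S \<times> E) v s \<omega>)"
  unfolding centred_def diff_conv_add_uminus prod_add[OF assms] prod_monomial_blocks
  by (simp add: mult.commute)

lemma prod_centred_integrable:
  assumes "finite J" "finite E" "v ` (J \<times> E) \<subseteq> A"
  shows "integrable M (\<lambda>\<omega>. \<Prod>j\<in>J. centred ({j} \<times> E) v s \<omega>)"
  unfolding prod_centred_expand[OF assms(1)]
  using assms by (intro Bochner_Integration.integrable_sum integrable_mult_right monomial_integrable)
    (auto intro: finite_subset)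

text \<open>Expanding the product gives \<open>2 ^ card J\<close> terms. Each is a product of at
  most \<open>card J + 1\<close> expectations of monomials with at most \<open>L\<close> factors,
  all bounded by \<open>1 + real L * C\<close>.\<close>

lemma norm_expectation_prod_centred_le:
  assumes J: "finite J" "finite E" "v ` (J \<times> E) \<subseteq> A" "card J * card E \<le> L" "0 \<le> C"
    and C: "\<And>k. k \<in> J \<times> E \<Longrightarrow> expectation (\<lambda>\<omega>. cmod (U (v k) \<omega>) ^ L) \<le> C"
  shows "cmod (expectation (\<lambda>\<omega>. \<Prod>j\<in>J. centred ({j} \<times> E) v s \<omega>))
    \<le> 2 ^ card J * (1 + real L * C) ^ (card J + 1)"
proof -
  define B where "B = 1 + real L * C"
  have B: "B \<ge> 1" using J by (simp add: B_def)
  have mono: "cmod (expectation (monomial (S \<times> E) v s)) \<le> B" if S: "S \<subseteq> J" for S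
  proof -
    have "card (S \<times> E) \<le> L"
      using S J by (metis card_cartesian_product card_mono le_trans mult_le_mono1)
    then show ?thesis unfolding B_def using S J C
      by (intro norm_expectation_monomial_le) (auto intro: finite_subset)
  qed
  have "expectation (\<lambda>\<omega>. \<Prod>j\<in>J. centred ({j} \<times> E) v s \<omega>) =
    (\<Sum>S\<in>Pow J. (\<Prod>j\<in>J - S. - expectation (monomial ({j} \<times> E) v s)) * expectation (monomial (S \<times> E) v s))"
    unfolding prod_centred_expand[OF J(1)] using J
    by (subst Bochner_Integration.integral_sum)
      (auto intro!: integrable_mult_right monomial_integrable intro: finite_subset)
  also have "cmod \<dots> \<le> (\<Sum>S\<in>Pow J. B ^ card J * B)"
  proof (intro order.trans[OF norm_sum] sum_mono)
    fix S assume S: "S \<in> Pow J"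
    have "(\<Prod>j\<in>J - S. cmod (expectation (monomial ({j} \<times> E) v s))) \<le> (\<Prod>j\<in>J - S. B)"
      using mono[of "{_}"] by (intro prod_mono) auto
    also have "\<dots> \<le> B ^ card J" using B J S by (auto intro!: power_increasing card_mono)
    finally show "cmod ((\<Prod>j\<in>J - S. - expectation (monomial ({j} \<times> E) v s)) * expectation (monomial (S \<times> E) v s))
      \<le> B ^ card J * B"
      using mono[of S] S B by (auto simp: norm_mult prod_norm[symmetric] intro!: mult_mono)
  qed
  finally show ?thesis using J by (simp add: B_def card_Pow mult.commute)
qed

text \<open>Expanding all centred factors except that of \<open>j\<close> leaves a linear
  combination of covariances between block \<open>j\<close> and the monomials over sets
  \<open>S\<close> without \<open>j\<close>, and \<open>factor\<close> makes each of them vanish.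
  The criterion covers both a block that is independent of the others and a block with a centred
  variable of its own.\<close>

lemma expectation_prod_centred_eq_0:
  assumes J: "finite J" "finite E" "v ` (J \<times> E) \<subseteq> A" and j: "j \<in> J"
    and factor: "\<And>S. S \<subseteq> J - {j} \<Longrightarrow> expectation (monomial (insert j S \<times> E) v s)
      = expectation (monomial ({j} \<times> E) v s) * expectation (monomial (S \<times> E) v s)"
  shows "expectation (\<lambda>\<omega>. \<Prod>j\<in>J. centred ({j} \<times> E) v s \<omega>) = 0"
proof -
  define b where "b S = (\<Prod>i\<in>J - {j} - S. - expectation (monomial ({i} \<times> E) v s))" for S
  have int: "integrable M (monomial (S \<times> E) v s)" if "S \<subseteq> J" for S
    using that J by (intro monomial_integrable) (auto intro: finite_subset)
  have "(\<Prod>i\<in>J. centred ({i} \<times> E) v s \<omega>) =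
    (\<Sum>S\<in>Pow (J - {j}). b S * (monomial (insert j S \<times> E) v s \<omega>
       - expectation (monomial ({j} \<times> E) v s) * monomial (S \<times> E) v s \<omega>))" for \<omega>
  proof -
    have "(\<Prod>i\<in>J. centred ({i} \<times> E) v s \<omega>) =
      centred ({j} \<times> E) v s \<omega> * (\<Sum>S\<in>Pow (J - {j}). b S * monomial (S \<times> E) v s \<omega>)"
      using J j by (simp add: prod.remove prod_centred_expand b_def)
    also have "\<dots> = (\<Sum>S\<in>Pow (J - {j}). b S * (monomial (insert j S \<times> E) v s \<omega>
       - expectation (monomial ({j} \<times> E) v s) * monomial (S \<times> E) v s \<omega>))"
      unfolding sum_distrib_left
    proof (rule sum.cong)
      fix S assume "S \<in> Pow (J - {j})"
      then have "finite S" "j \<notin> S" using J by (auto intro: finite_subset)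
      then have "monomial (insert j S \<times> E) v s \<omega> = monomial ({j} \<times> E) v s \<omega> * monomial (S \<times> E) v s \<omega>"
        using prod_monomial_blocks[where S = "insert j S" and E = E and v = v and s = s and \<omega> = \<omega>]
          prod_monomial_blocks[where S = S and E = E and v = v and s = s and \<omega> = \<omega>] by simp
      then show "centred ({j} \<times> E) v s \<omega> * (b S * monomial (S \<times> E) v s \<omega>) =
        b S * (monomial (insert j S \<times> E) v s \<omega>
       - expectation (monomial ({j} \<times> E) v s) * monomial (S \<times> E) v s \<omega>)"
        by (simp add: centred_def algebra_simps)
    qed simp
    finally show ?thesis .
  qed
  then have "expectation (\<lambda>\<omega>. \<Prod>i\<in>J. centred ({i} \<times> E) v s \<omega>) =
    (\<Sum>S\<in>Pow (J - {j}). expectation (\<lambda>\<omega>. b S * (monomial (insert j S \<times> E) v s \<omega>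
       - expectation (monomial ({j} \<times> E) v s) * monomial (S \<times> E) v s \<omega>)))"
    using int j by (simp, subst Bochner_Integration.integral_sum)
      (auto intro!: integrable_mult_right Bochner_Integration.integrable_diff int)
  also have "\<dots> = (\<Sum>S\<in>Pow (J - {j}). 0)"
  proof (rule sum.cong)
    fix S assume S: "S \<in> Pow (J - {j})"
    then have "integrable M (monomial (insert j S \<times> E) v s)" "integrable M (monomial (S \<times> E) v s)"
      using j by (auto intro!: int)
    then show "expectation (\<lambda>\<omega>. b S * (monomial (insert j S \<times> E) v s \<omega>
       - expectation (monomial ({j} \<times> E) v s) * monomial (S \<times> E) v s \<omega>)) = 0"
      using factor[of S] S by simp
  qed simp
  finally show ?thesis by simp
qed

end

subsection \<open>Traces of test graphs\<close>

text \<open>A tuple of maps on \<open>V\<close> is the same as one function on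
  \<open>J \<times> V\<close>, and the union of the images becomes the image of that
  function.\<close>

lemma card_tuples_small_union:
  assumes "finite J" "J \<noteq> {}" "finite V" "V \<noteq> {}"
  shows "card {\<Phi> \<in> J \<rightarrow>\<^sub>E (V \<rightarrow>\<^sub>E {..<n}). card (\<Union>j\<in>J. \<Phi> j ` V) \<le> K}
    \<le> K ^ (card J * card V) * n ^ K"
proof -
  let ?T = "{\<Phi> \<in> J \<rightarrow>\<^sub>E (V \<rightarrow>\<^sub>E {..<n}). card (\<Union>j\<in>J. \<Phi> j ` V) \<le> K}"
  let ?F = "{f \<in> (J \<times> V) \<rightarrow>\<^sub>E {..<n}. card (f ` (J \<times> V)) \<le> K}"
  define c where "c \<Phi> = restrict (\<lambda>(j, v). \<Phi> j v) (J \<times> V)" for \<Phi> :: "'a \<Rightarrow> 'b \<Rightarrow> nat"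
  have "inj_on c ?T"
  proof (rule inj_onI)
    fix \<Phi> \<Psi> assume \<Phi>: "\<Phi> \<in> ?T" and \<Psi>: "\<Psi> \<in> ?T" and eq: "c \<Phi> = c \<Psi>"
    have "\<Phi> j v = \<Psi> j v" if "j \<in> J" "v \<in> V" for j v
      using fun_cong[OF eq, of "(j, v)"] that by (simp add: c_def)
    then have "\<Phi> j = \<Psi> j" if "j \<in> J" for j
      using that \<Phi> \<Psi> by (intro PiE_ext[of "\<Phi> j" V "\<lambda>_. {..<n}" "\<Psi> j"]) (auto dest: PiE_mem)
    then show "\<Phi> = \<Psi>"
      using \<Phi> \<Psi> by (intro PiE_ext[of \<Phi> J "\<lambda>_. V \<rightarrow>\<^sub>E {..<n}" \<Psi>]) auto
  qed
  moreover have "c ` ?T \<subseteq> ?F"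
  proof
    fix f assume "f \<in> c ` ?T"
    then obtain \<Phi> where \<Phi>: "\<Phi> \<in> ?T" and f: "f = c \<Phi>" by blast
    have "f ` (J \<times> V) = (\<Union>j\<in>J. \<Phi> j ` V)" by (force simp: f c_def)
    moreover have "f \<in> (J \<times> V) \<rightarrow>\<^sub>E {..<n}"
      using \<Phi> by (auto simp: f c_def PiE_iff)
    ultimately show "f \<in> ?F" using \<Phi> by simp
  qed
  moreover have "finite ?F" using assms by (simp add: finite_PiE)
  ultimately have "card ?T \<le> card ?F" by (rule card_inj_on_le)
  also have "\<dots> \<le> K ^ card (J \<times> V) * n ^ K"
    using assms by (intro card_functions_small_image) auto
  finally show ?thesis by (simp add: card_cartesian_product)
qed

text \<open>Even factors are \<open>z\<close> and odd ones \<open>cnj z\<close>; as a product, the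
  power can be distributed over the sum that makes up the trace.\<close>

lemma power_cmod_eq_prod_twist:
  "complex_of_real (cmod z ^ (2 * m)) = (\<Prod>j<2 * m. twist (odd j) z)"
proof (induction m)
  case (Suc m)
  have "complex_of_real (cmod z ^ (2 * Suc m)) = complex_of_real (cmod z ^ (2 * m)) * complex_of_real ((cmod z)\<^sup>2)"
    by (simp add: power2_eq_square)
  also have "\<dots> = (\<Prod>j<2 * m. twist (odd j) z) * (z * cnj z)"
    by (simp only: Suc complex_norm_square)
  also have "\<dots> = (\<Prod>j<2 * Suc m. twist (odd j) z)"
    by (simp add: twist_def)
  finally show ?case .
qed simp

text \<open>Convexity of a power on the nonnegative reals: its graph lies above the tangent at
  \<open>c\<close>. In the induction the error is a multiple of the square of
  \<open>t - c\<close>.\<close>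

lemma power_tangent_line:
  fixes t c :: real
  assumes "0 \<le> t" "0 \<le> c"
  shows "c ^ Suc m + real (Suc m) * c ^ m * (t - c) \<le> t ^ Suc m"
proof (induction m)
  case (Suc m)
  have "c ^ Suc (Suc m) + real (Suc (Suc m)) * c ^ Suc m * (t - c)
    = t * (c ^ Suc m + real (Suc m) * c ^ m * (t - c)) - real (Suc m) * c ^ m * (t - c)\<^sup>2"
    by (simp add: algebra_simps power2_eq_square)
  also have "\<dots> \<le> t * (c ^ Suc m + real (Suc m) * c ^ m * (t - c))"
    using assms by simp
  also have "\<dots> \<le> t * t ^ Suc m" using Suc assms by (intro mult_left_mono) auto
  finally show ?case by simp
qed simp

text \<open>Jensen's inequality for powers, obtained by integrating the tangent line at the mean,
  whose linear part has expectation 0.\<close>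

lemma (in prob_space) power_expectation_le:
  fixes f :: "'a \<Rightarrow> real"
  assumes "integrable M f" "integrable M (\<lambda>\<omega>. f \<omega> ^ m)" "\<And>\<omega>. 0 \<le> f \<omega>"
  shows "expectation f ^ m \<le> expectation (\<lambda>\<omega>. f \<omega> ^ m)"
proof (cases m)
  case (Suc k)
  define c where "c = expectation f"
  have "c ^ m = expectation (\<lambda>\<omega>. c ^ Suc k + real (Suc k) * c ^ k * (f \<omega> - c))"
    using assms(1) Suc by (simp add: c_def prob_space)
  also have "\<dots> \<le> expectation (\<lambda>\<omega>. f \<omega> ^ m)"
    unfolding Suc using assms Suc
    by (intro integral_mono power_tangent_line) (auto simp: c_def)
  finally show ?thesis by (simp add: c_def)
qed (simp add: prob_space)

text \<open>Positions \<open>(a, b)\<close> and \<open>(b, a)\<close> carry the same variable up to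
  conjugation; the representative in the upper triangle is chosen. Equal indices thus mean equal
  labels and equal undirected edges.\<close>

definition entry_index :: "'i \<Rightarrow> nat \<Rightarrow> nat \<Rightarrow> 'i \<times> nat \<times> nat" where
  "entry_index i a b = (i, min a b, max a b)"

lemma entry_index_eq_iff:
  "entry_index i a b = entry_index i' a' b' \<longleftrightarrow> i = i' \<and> {a, b} = {a', b'}"
  by (auto simp: entry_index_def doubleton_eq_iff min_def max_def)

lemma entry_index_mem:
  "i \<in> I \<Longrightarrow> a < n \<Longrightarrow> b < n \<Longrightarrow> entry_index i a b \<in> I \<times> upper_indices n"
  by (auto simp: entry_index_def upper_indices_def)

section \<open>The matrix entries as independent variables\<close>

context wigner_family
begin

definition entry :: "nat \<Rightarrow> 'i \<times> nat \<times> nat \<Rightarrow> 'a \<Rightarrow> complex" where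
  "entry n = (\<lambda>(i, jk) \<omega>. X n i \<omega> $$ jk)"

text \<open>The finite supremum in the moment assumption supplies one real constant that serves all
  dimensions \<open>n\<close> at once.\<close>

lemma entry_moment_bound:
  assumes "finite I0" "I0 \<subseteq> I"
  obtains C where "0 \<le> C" "\<And>n w. w \<in> I0 \<times> upper_indices n \<Longrightarrow>
    (\<integral>\<^sup>+\<omega>. ennreal (cmod (entry n w \<omega>) ^ l) \<partial>M n) \<le> ennreal C"
proof -
  define S where "S = (SUP n. SUP i\<in>I0. SUP jk\<in>upper_indices n.
            \<integral>\<^sup>+\<omega>. ennreal (cmod (X n i \<omega> $$ jk) ^ l) \<partial>M n)"
  have S: "S < \<infinity>" using moments[OF assms] by (simp add: S_def)
  have "(\<integral>\<^sup>+\<omega>. ennreal (cmod (entry n w \<omega>) ^ l) \<partial>M n) \<le> S" if "w \<in> I0 \<times> upper_indices n" for n w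
    using that unfolding S_def
    by (auto simp: entry_def intro!: SUP_upper2[of n] SUP_upper2[of "fst w"] SUP_upper2[of "snd w"])
  moreover have "ennreal (enn2real S) = S" using S by simp
  ultimately show thesis by (intro that[of "enn2real S"]) auto
qed

sublocale entries: moment_family "M n" "entry n" "I \<times> upper_indices n" for n
proof -
  interpret prob_space "M n" by (rule prob_spaces)
  have indep: "indep_vars (\<lambda>_. borel) (entry n) (I \<times> upper_indices n)"
    using independent[of n] by (simp add: entry_def)
  show "moment_family (M n) (entry n) (I \<times> upper_indices n)"
  proof
    show "indep_vars (\<lambda>_. borel) (entry n) (I \<times> upper_indices n)" by (rule indep)
    fix w l assume w: "w \<in> I \<times> upper_indices n"
    \<comment> \<open>The moment assumption concerns finite sets of labels only, while
      \<open>I\<close> may be infinite; for the integrability of one variable the singleton of its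
      label suffices.\<close>
    have sub: "{fst w} \<subseteq> I" using w by auto
    obtain C where "\<And>n w'. w' \<in> {fst w} \<times> upper_indices n \<Longrightarrow>
        (\<integral>\<^sup>+\<omega>. ennreal (cmod (entry n w' \<omega>) ^ l) \<partial>M n) \<le> ennreal C"
      using entry_moment_bound[OF finite.insertI[OF finite.emptyI] sub] by blast
    then have C: "(\<integral>\<^sup>+\<omega>. ennreal (cmod (entry n w \<omega>) ^ l) \<partial>M n) \<le> ennreal C"
      using w by (simp add: mem_Times_iff)
    have [measurable]: "entry n w \<in> borel_measurable (M n)"
      using indep w by (auto simp: indep_vars_def)
    show "integrable (M n) (\<lambda>\<omega>. cmod (entry n w \<omega>) ^ l)"
      using C by (intro integrableI_bounded) (auto simp: le_less_trans norm_power)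
  qed
qed

lemma entry_moment_le:
  assumes "finite I0" "I0 \<subseteq> I"
  obtains C where "0 \<le> C" "\<And>n w. w \<in> I0 \<times> upper_indices n \<Longrightarrow>
    (\<integral>\<omega>. cmod (entry n w \<omega>) ^ l \<partial>M n) \<le> C"
proof -
  obtain C where C: "0 \<le> C" "\<And>n w. w \<in> I0 \<times> upper_indices n \<Longrightarrow>
    (\<integral>\<^sup>+\<omega>. ennreal (cmod (entry n w \<omega>) ^ l) \<partial>M n) \<le> ennreal C"
    using entry_moment_bound[OF assms] by blast
  have "(\<integral>\<omega>. cmod (entry n w \<omega>) ^ l \<partial>M n) \<le> C" if w: "w \<in> I0 \<times> upper_indices n" for n w
  proof -
    have "integrable (M n) (\<lambda>\<omega>. cmod (entry n w \<omega>) ^ l)"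
      using w assms(2) by (intro entries.moments) auto
    then have "ennreal (\<integral>\<omega>. cmod (entry n w \<omega>) ^ l \<partial>M n) \<le> ennreal C"
      using C(2)[OF w] by (subst nn_integral_eq_integral[symmetric]) auto
    then show ?thesis using C(1) by simp
  qed
  with C(1) show thesis by (rule that)
qed

text \<open>An entry below the diagonal is, by Hermitian symmetry, the conjugate of the mirrored
  entry above it.\<close>

lemma X_eq_entry:
  assumes "i \<in> I" "\<omega> \<in> space (M n)" "a < n" "b < n"
  shows "X n i \<omega> $$ (a, b) = twist (b < a) (entry n (entry_index i a b) \<omega>)"
proof (cases "b < a")
  case True
  have "X n i \<omega> $$ (a, b) = mat_adjoint (X n i \<omega>) $$ (a, b)"
    using hermitian[OF assms(1,2)] by simp
  also have "\<dots> = cnj (X n i \<omega> $$ (b, a))"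
    using dims[OF assms(1,2)] assms(3,4) by (simp add: mat_adjoint_def mat_of_rows_index)
  finally show ?thesis using True by (simp add: entry_index_def entry_def twist_def)
qed (simp add: entry_index_def entry_def twist_def)

lemma expectation_entry:
  assumes "i \<in> I" "a < n" "b < n" "a \<noteq> b"
  shows "(\<integral>\<omega>. entry n (entry_index i a b) \<omega> \<partial>M n) = 0"
    and "(\<integral>\<omega>. (cmod (entry n (entry_index i a b) \<omega>))\<^sup>2 \<partial>M n) = 1"
  using assms mean_zero[of i "min a b" "max a b" n] variance_one[of i "min a b" "max a b" n]
  by (auto simp: entry_def entry_index_def)

end

definition graph_term ::
    "('v, 'e) pre_digraph \<Rightarrow> ('e \<Rightarrow> 'i) \<Rightarrow> ('i \<Rightarrow> complex mat) \<Rightarrow> ('v \<Rightarrow> nat) \<Rightarrow> complex" where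
  "graph_term G \<gamma> A \<phi> = (\<Prod>e\<in>arcs G. A (\<gamma> e) $$ (\<phi> (head G e), \<phi> (tail G e)))"

lemma graph_trace_eq: "graph_trace n G \<gamma> A = (\<Sum>\<phi>\<in>verts G \<rightarrow>\<^sub>E {..<n}. graph_term G \<gamma> A \<phi>)"
  by (simp add: graph_trace_def graph_term_def)

text \<open>The pair \<open>(j, e)\<close> stands for the factor of the arc \<open>e\<close> in the
  term of the \<open>j\<close>-th map, so a whole tuple of terms becomes a single monomial.\<close>

definition block_index ::
    "('v, 'e) pre_digraph \<Rightarrow> ('e \<Rightarrow> 'i) \<Rightarrow> (nat \<Rightarrow> 'v \<Rightarrow> nat) \<Rightarrow> nat \<times> 'e \<Rightarrow> 'i \<times> nat \<times> nat" where
  "block_index G \<gamma> \<Phi> = (\<lambda>(j, e). entry_index (\<gamma> e) (\<Phi> j (head G e)) (\<Phi> j (tail G e)))"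

text \<open>Blocks with an odd number carry an additional complex conjugation.\<close>

definition block_conj ::
    "('v, 'e) pre_digraph \<Rightarrow> (nat \<Rightarrow> 'v \<Rightarrow> nat) \<Rightarrow> nat \<times> 'e \<Rightarrow> bool" where
  "block_conj G \<Phi> = (\<lambda>(j, e). odd j \<noteq> (\<Phi> j (tail G e) < \<Phi> j (head G e)))"

section \<open>Expansion of the central moment of a trace\<close>

locale wigner_graph = wigner_family M I X \<beta> + test_graph I G \<gamma>
  for M :: "nat \<Rightarrow> 'a measure" and I :: "'i set" and X \<beta>
    and G :: "('v, 'e) pre_digraph" and \<gamma> :: "'e \<Rightarrow> 'i"
begin

abbreviation gterm :: "nat \<Rightarrow> ('v \<Rightarrow> nat) \<Rightarrow> 'a \<Rightarrow> complex" where
  "gterm n \<phi> \<omega> \<equiv> graph_term G \<gamma> (\<lambda>i. X n i \<omega>) \<phi>"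

abbreviation block :: "nat \<Rightarrow> (nat \<Rightarrow> 'v \<Rightarrow> nat) \<Rightarrow> nat set \<Rightarrow> 'a \<Rightarrow> complex" where
  "block n \<Phi> S \<equiv> entries.monomial n (S \<times> arcs G) (block_index G \<gamma> \<Phi>) (block_conj G \<Phi>)"

abbreviation cblock :: "nat \<Rightarrow> (nat \<Rightarrow> 'v \<Rightarrow> nat) \<Rightarrow> nat \<Rightarrow> 'a \<Rightarrow> complex" where
  "cblock n \<Phi> j \<equiv> entries.centred n ({j} \<times> arcs G) (block_index G \<gamma> \<Phi>) (block_conj G \<Phi>)"

lemma block_index_mem:
  assumes "\<And>j. j \<in> S \<Longrightarrow> \<Phi> j \<in> verts G \<rightarrow>\<^sub>E {..<n}"
  shows "block_index G \<gamma> \<Phi> ` (S \<times> arcs G) \<subseteq> \<gamma> ` arcs G \<times> upper_indices n"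
    and "block_index G \<gamma> \<Phi> ` (S \<times> arcs G) \<subseteq> I \<times> upper_indices n"
proof -
  have "block_index G \<gamma> \<Phi> (j, e) \<in> \<gamma> ` arcs G \<times> upper_indices n" if "j \<in> S" "e \<in> arcs G" for j e
    using PiE_mem[OF assms[OF that(1)]] that(2) head_in_verts[OF that(2)] tail_in_verts[OF that(2)]
    unfolding block_index_def by (auto intro!: entry_index_mem)
  then show "block_index G \<gamma> \<Phi> ` (S \<times> arcs G) \<subseteq> \<gamma> ` arcs G \<times> upper_indices n"
    by (intro image_subsetI) (elim SigmaE, simp)
  then show "block_index G \<gamma> \<Phi> ` (S \<times> arcs G) \<subseteq> I \<times> upper_indices n"
    by (rule order.trans[OF _ Sigma_mono]) (use labels in auto)
qed

lemma twist_gterm: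
  assumes "\<omega> \<in> space (M n)" "\<Phi> j \<in> verts G \<rightarrow>\<^sub>E {..<n}"
  shows "twist (odd j) (gterm n (\<Phi> j) \<omega>) = block n \<Phi> {j} \<omega>"
proof -
  have "twist (odd j) (X n (\<gamma> e) \<omega> $$ (\<Phi> j (head G e), \<Phi> j (tail G e))) =
      twist (block_conj G \<Phi> (j, e)) (entry n (block_index G \<gamma> \<Phi> (j, e)) \<omega>)" if "e \<in> arcs G" for e
    using that assms labels PiE_mem[OF assms(2)]
    by (simp add: X_eq_entry block_conj_def block_index_def twist_twist)
  then have "twist (odd j) (gterm n (\<Phi> j) \<omega>)
    = (\<Prod>e\<in>arcs G. twist (block_conj G \<Phi> (j, e)) (entry n (block_index G \<gamma> \<Phi> (j, e)) \<omega>))"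
    by (simp add: graph_term_def twist_prod)
  also have "\<dots> = block n \<Phi> {j} \<omega>"
    by (simp add: entries.monomial_def prod.cartesian_product')
  finally show ?thesis .
qed

lemma block_integrable:
  assumes "\<And>j. j \<in> S \<Longrightarrow> \<Phi> j \<in> verts G \<rightarrow>\<^sub>E {..<n}" "finite S"
  shows "integrable (M n) (block n \<Phi> S)"
  using assms block_index_mem(2)[of S \<Phi> n] by (intro entries.monomial_integrable) auto

text \<open>Equal variables have equal undirected image edges, so by \<open>single\<close> the
  variable of \<open>(j, e)\<close> occurs only once. It is off the diagonal and therefore
  centred.\<close>

lemma expectation_block_eq_0:
  assumes \<Phi>: "\<And>k. k \<in> S \<Longrightarrow> \<Phi> k \<in> verts G \<rightarrow>\<^sub>E {..<n}" and S: "finite S" "j \<in> S"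
    and e: "e \<in> arcs G" "\<Phi> j (head G e) \<noteq> \<Phi> j (tail G e)"
    and single: "\<And>k f. k \<in> S \<Longrightarrow> f \<in> arcs G \<Longrightarrow> (k, f) \<noteq> (j, e) \<Longrightarrow>
      {\<Phi> k (head G f), \<Phi> k (tail G f)} \<noteq> {\<Phi> j (head G e), \<Phi> j (tail G e)}"
  shows "(\<integral>\<omega>. block n \<Phi> S \<omega> \<partial>M n) = 0"
proof (rule entries.expectation_monomial_eq_0[where k = "(j, e)"])
  let ?v = "block_index G \<gamma> \<Phi>"
  show "(\<integral>\<omega>. entry n (?v (j, e)) \<omega> \<partial>M n) = 0"
    using PiE_mem[OF \<Phi>[OF S(2)]] e labels unfolding block_index_def by (simp add: expectation_entry)
  show "?v i \<noteq> ?v (j, e)" if i: "i \<in> S \<times> arcs G" "i \<noteq> (j, e)" for i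
  proof
    assume "?v i = ?v (j, e)"
    then have "{\<Phi> (fst i) (head G (snd i)), \<Phi> (fst i) (tail G (snd i))}
        = {\<Phi> j (head G e), \<Phi> j (tail G e)}"
      by (simp add: block_index_def entry_index_eq_iff case_prod_beta)
    then show False using single[of "fst i" "snd i"] i by auto
  qed
  show "?v ` (S \<times> arcs G) \<subseteq> I \<times> upper_indices n" by (rule block_index_mem(2)[OF \<Phi>])
qed (use S e in simp_all)

lemma gterm_integrable:
  assumes "\<phi> \<in> verts G \<rightarrow>\<^sub>E {..<n}"
  shows "integrable (M n) (gterm n \<phi>)"
proof -
  \<comment> \<open>The block number 0 is even and so adds no conjugation to the term.\<close>
  have "integrable (M n) (block n (\<lambda>_. \<phi>) {0})" using assms by (intro block_integrable) auto
  moreover have "gterm n \<phi> \<omega> = block n (\<lambda>_. \<phi>) {0} \<omega>" if "\<omega> \<in> space (M n)" for \<omega>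
    using twist_gterm[of \<omega> n "\<lambda>_. \<phi>" 0] that assms by (simp add: twist_def)
  ultimately show ?thesis by (simp cong: Bochner_Integration.integrable_cong)
qed

lemma twist_centred_gterm:
  assumes "\<omega> \<in> space (M n)" "\<Phi> j \<in> verts G \<rightarrow>\<^sub>E {..<n}"
  shows "twist (odd j) (gterm n (\<Phi> j) \<omega> - (\<integral>\<omega>'. gterm n (\<Phi> j) \<omega>' \<partial>M n)) = cblock n \<Phi> j \<omega>"
proof -
  have "(\<integral>\<omega>'. twist (odd j) (gterm n (\<Phi> j) \<omega>') \<partial>M n) = (\<integral>\<omega>'. block n \<Phi> {j} \<omega>' \<partial>M n)"
    using assms(2) by (intro Bochner_Integration.integral_cong) (auto simp: twist_gterm)
  then show ?thesis
    using assms by (simp add: twist_diff twist_integral twist_gterm entries.centred_def)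
qed

lemma centred_graph_trace:
  "graph_trace n G \<gamma> (\<lambda>i. X n i \<omega>) - (\<integral>\<omega>'. graph_trace n G \<gamma> (\<lambda>i. X n i \<omega>') \<partial>M n) =
    (\<Sum>\<phi>\<in>verts G \<rightarrow>\<^sub>E {..<n}. gterm n \<phi> \<omega> - (\<integral>\<omega>'. gterm n \<phi> \<omega>' \<partial>M n))"
proof -
  have "(\<integral>\<omega>'. graph_trace n G \<gamma> (\<lambda>i. X n i \<omega>') \<partial>M n)
      = (\<Sum>\<phi>\<in>verts G \<rightarrow>\<^sub>E {..<n}. \<integral>\<omega>'. gterm n \<phi> \<omega>' \<partial>M n)"
    unfolding graph_trace_eq by (rule Bochner_Integration.integral_sum[OF gterm_integrable])
  then show ?thesis by (simp only: graph_trace_eq sum_subtractf)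
qed

lemma power_centred_graph_trace:
  assumes "\<omega> \<in> space (M n)"
  shows "complex_of_real (cmod (graph_trace n G \<gamma> (\<lambda>i. X n i \<omega>) -
      (\<integral>\<omega>'. graph_trace n G \<gamma> (\<lambda>i. X n i \<omega>') \<partial>M n)) ^ (2 * m)) =
    (\<Sum>\<Phi>\<in>{..<2 * m} \<rightarrow>\<^sub>E (verts G \<rightarrow>\<^sub>E {..<n}). \<Prod>j<2 * m. cblock n \<Phi> j \<omega>)"
  unfolding centred_graph_trace power_cmod_eq_prod_twist twist_sum
proof -
  have "(\<Prod>j<2 * m. \<Sum>\<phi>\<in>verts G \<rightarrow>\<^sub>E {..<n}.
      twist (odd j) (gterm n \<phi> \<omega> - (\<integral>\<omega>'. gterm n \<phi> \<omega>' \<partial>M n))) =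
    (\<Sum>\<Phi>\<in>{..<2 * m} \<rightarrow>\<^sub>E (verts G \<rightarrow>\<^sub>E {..<n}). \<Prod>j<2 * m.
      twist (odd j) (gterm n (\<Phi> j) \<omega> - (\<integral>\<omega>'. gterm n (\<Phi> j) \<omega>' \<partial>M n)))"
    by (rule prod_sum_PiE) (simp_all add: finite_PiE)
  also have "(\<Sum>\<Phi>\<in>{..<2 * m} \<rightarrow>\<^sub>E (verts G \<rightarrow>\<^sub>E {..<n}). \<Prod>j<2 * m.
      twist (odd j) (gterm n (\<Phi> j) \<omega> - (\<integral>\<omega>'. gterm n (\<Phi> j) \<omega>' \<partial>M n))) =
    (\<Sum>\<Phi>\<in>{..<2 * m} \<rightarrow>\<^sub>E (verts G \<rightarrow>\<^sub>E {..<n}). \<Prod>j<2 * m. cblock n \<Phi> j \<omega>)"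
    by (rule sum.cong[OF refl], rule prod.cong[OF refl], rule twist_centred_gterm[OF assms], erule PiE_mem)
  finally show "(\<Prod>j<2 * m. \<Sum>\<phi>\<in>verts G \<rightarrow>\<^sub>E {..<n}.
      twist (odd j) (gterm n \<phi> \<omega> - (\<integral>\<omega>'. gterm n \<phi> \<omega>' \<partial>M n))) =
    (\<Sum>\<Phi>\<in>{..<2 * m} \<rightarrow>\<^sub>E (verts G \<rightarrow>\<^sub>E {..<n}). \<Prod>j<2 * m. cblock n \<Phi> j \<omega>)" .
qed

lemma cblocks_integrable:
  assumes "\<Phi> \<in> {..<2 * m} \<rightarrow>\<^sub>E (verts G \<rightarrow>\<^sub>E {..<n})"
  shows "integrable (M n) (\<lambda>\<omega>. \<Prod>j<2 * m. cblock n \<Phi> j \<omega>)"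
  by (rule entries.prod_centred_integrable[OF _ _ block_index_mem(2)[OF PiE_mem[OF assms]]]) simp_all

text \<open>Stated in the complex numbers, because the expectations on the right need not be real
  one by one.\<close>

lemma central_moment_graph_trace:
  "complex_of_real (central_moment (M n) (\<lambda>\<omega>. graph_trace n G \<gamma> (\<lambda>i. X n i \<omega>)) (2 * m)) =
    (\<Sum>\<Phi>\<in>{..<2 * m} \<rightarrow>\<^sub>E (verts G \<rightarrow>\<^sub>E {..<n}). \<integral>\<omega>. (\<Prod>j<2 * m. cblock n \<Phi> j \<omega>) \<partial>M n)"
  unfolding central_moment_def integral_complex_of_real[symmetric]
  by (rule trans[OF Bochner_Integration.integral_cong[OF refl power_centred_graph_trace]
        Bochner_Integration.integral_sum[OF cblocks_integrable]])

lemma integrable_power_centred_graph_trace: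
  "integrable (M n) (\<lambda>\<omega>. cmod (graph_trace n G \<gamma> (\<lambda>i. X n i \<omega>) -
      (\<integral>\<omega>'. graph_trace n G \<gamma> (\<lambda>i. X n i \<omega>') \<partial>M n)) ^ (2 * m))"
proof -
  have int: "integrable (M n) (\<lambda>\<omega>. \<Sum>\<Phi>\<in>{..<2 * m} \<rightarrow>\<^sub>E (verts G \<rightarrow>\<^sub>E {..<n}). \<Prod>j<2 * m. cblock n \<Phi> j \<omega>)"
    by (rule Bochner_Integration.integrable_sum[OF cblocks_integrable])
  have "integrable (M n) (\<lambda>\<omega>. complex_of_real (cmod (graph_trace n G \<gamma> (\<lambda>i. X n i \<omega>) -
      (\<integral>\<omega>'. graph_trace n G \<gamma> (\<lambda>i. X n i \<omega>') \<partial>M n)) ^ (2 * m)))"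
    by (rule iffD2[OF Bochner_Integration.integrable_cong[OF refl power_centred_graph_trace] int])
  then show ?thesis by (simp only: complex_of_real_integrable_eq)
qed

text \<open>An image edge that is not repeated, or an image disjoint from all the others, would make
  one block uncorrelated with all products of other blocks, and the expectation would vanish.
  Otherwise \<open>card_union_images\<close> applies to the \<open>2 * m\<close> maps.\<close>

lemma nonzero_cblocks_small:
  assumes \<Phi>: "\<Phi> \<in> {..<2 * m} \<rightarrow>\<^sub>E (verts G \<rightarrow>\<^sub>E {..<n})"
    and nz: "(\<integral>\<omega>. (\<Prod>j<2 * m. cblock n \<Phi> j \<omega>) \<partial>M n) \<noteq> 0"
  shows "card (\<Union>j<2 * m. \<Phi> j ` verts G) \<le> m * (card (non_loops G) + 1)"
proof -
  let ?v = "block_index G \<gamma> \<Phi>"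
  have \<Phi>': "\<Phi> j \<in> verts G \<rightarrow>\<^sub>E {..<n}" if "j \<in> {..<2 * m}" for j
    using \<Phi> that by (rule PiE_mem)
  have mem: "?v ` (S \<times> arcs G) \<subseteq> I \<times> upper_indices n" if "S \<subseteq> {..<2 * m}" for S
    by (rule block_index_mem(2), rule \<Phi>') (use that in blast)
  have zero: False if j: "j \<in> {..<2 * m}" and
    factor: "\<And>S. S \<subseteq> {..<2 * m} - {j} \<Longrightarrow> (\<integral>\<omega>. block n \<Phi> (insert j S) \<omega> \<partial>M n)
      = (\<integral>\<omega>. block n \<Phi> {j} \<omega> \<partial>M n) * (\<integral>\<omega>. block n \<Phi> S \<omega> \<partial>M n)" for j
    using nz entries.expectation_prod_centred_eq_0[OF _ _ mem[OF subset_refl] j factor] by simp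
  have "2 * card (\<Union>j\<in>{..<2 * m}. \<Phi> j ` verts G) \<le> card {..<2 * m} * (card (non_loops G) + 1)"
  proof (rule card_union_images)
    fix j e assume j: "j \<in> {..<2 * m}" and e: "e \<in> arcs G" "\<Phi> j (head G e) \<noteq> \<Phi> j (tail G e)"
    show "\<exists>k\<in>{..<2 * m}. \<exists>f\<in>arcs G. (k, f) \<noteq> (j, e) \<and>
        {\<Phi> k (head G f), \<Phi> k (tail G f)} = {\<Phi> j (head G e), \<Phi> j (tail G e)}"
    proof (rule ccontr)
      assume none: "\<not> ?thesis"
      \<comment> \<open>Every product that contains block \<open>j\<close> has expectation 0, so
        both sides of the factorization are 0.\<close>
      have vanish: "(\<integral>\<omega>. block n \<Phi> S \<omega> \<partial>M n) = 0" if S: "j \<in> S" "S \<subseteq> {..<2 * m}" for S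
        using e none S \<Phi>' finite_subset[OF S(2)]
        by (intro expectation_block_eq_0[where j = j and e = e]) blast+
      have "(\<integral>\<omega>. block n \<Phi> (insert j S) \<omega> \<partial>M n)
        = (\<integral>\<omega>. block n \<Phi> {j} \<omega> \<partial>M n) * (\<integral>\<omega>. block n \<Phi> S \<omega> \<partial>M n)"
        if "S \<subseteq> {..<2 * m} - {j}" for S
      proof -
        have "insert j S \<subseteq> {..<2 * m}" "{j} \<subseteq> {..<2 * m}" using that j by blast+
        then show ?thesis using vanish[of "insert j S"] vanish[of "{j}"] by simp
      qed
      then show False by (rule zero[OF j])
    qed
  next
    fix j assume j: "j \<in> {..<2 * m}"
    show "\<exists>k\<in>{..<2 * m}. k \<noteq> j \<and> \<Phi> j ` verts G \<inter> \<Phi> k ` verts G \<noteq> {}"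
    proof (rule ccontr)
      assume none: "\<not> ?thesis"
      have "(\<integral>\<omega>. block n \<Phi> (insert j S) \<omega> \<partial>M n)
        = (\<integral>\<omega>. block n \<Phi> {j} \<omega> \<partial>M n) * (\<integral>\<omega>. block n \<Phi> S \<omega> \<partial>M n)"
        if S: "S \<subseteq> {..<2 * m} - {j}" for S
      proof -
        \<comment> \<open>A variable shared by two blocks would give a vertex shared by the two
          images; without one, the blocks are independent.\<close>
        have "?v (k, f) \<noteq> ?v (j, e)" if "k \<in> S" "e \<in> arcs G" "f \<in> arcs G" for k e f
        proof
          assume "?v (k, f) = ?v (j, e)"
          then have "?v (j, e) = ?v (k, f)" by (rule sym)
          then have "{\<Phi> j (head G e), \<Phi> j (tail G e)} = {\<Phi> k (head G f), \<Phi> k (tail G f)}"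
            by (simp add: block_index_def entry_index_eq_iff)
          then have "\<Phi> j (head G e) \<in> \<Phi> j ` verts G \<inter> \<Phi> k ` verts G"
            using head_in_verts[OF that(2)] head_in_verts[OF that(3)] tail_in_verts[OF that(3)]
            by (simp add: doubleton_eq_iff) (metis imageI)
          then show False using none that S by blast
        qed
        then have "?v ` ({j} \<times> arcs G) \<inter> ?v ` (S \<times> arcs G) = {}" by auto
        moreover have "insert j S \<times> arcs G = {j} \<times> arcs G \<union> S \<times> arcs G" by auto
        moreover have "finite S" using S by (rule finite_subset) simp
        moreover have "insert j S \<subseteq> {..<2 * m}" using S j by blast
        ultimately show ?thesis
          using mem[of "insert j S"] by (simp add: entries.expectation_monomial_Un)
      qed
      then show False by (rule zero[OF j])
    qed
  qed simp
  then show ?thesis by simp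
qed

text \<open>The number of contributing tuples is of order \<open>n ^ K\<close>, and each
  contribution is bounded independently of \<open>n\<close>.\<close>

lemma central_moment_upper:
  assumes m: "m \<ge> 1"
  shows "(\<lambda>n. central_moment (M n) (\<lambda>\<omega>. graph_trace n G \<gamma> (\<lambda>i. X n i \<omega>)) (2 * m))
    \<in> O(\<lambda>n. real n ^ (m * (card (non_loops G) + 1)))"
proof -
  define K where "K = m * (card (non_loops G) + 1)"
  define L where "L = 2 * m * card (arcs G)"
  obtain C where C: "0 \<le> C" "\<And>n w. w \<in> \<gamma> ` arcs G \<times> upper_indices n \<Longrightarrow>
    (\<integral>\<omega>. cmod (entry n w \<omega>) ^ L \<partial>M n) \<le> C"
    using entry_moment_le[of "\<gamma> ` arcs G" L] labels by (metis finite_arcs finite_imageI image_subsetI)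
  define B where "B = 2 ^ (2 * m) * (1 + real L * C) ^ (2 * m + 1)"
  have B: "0 \<le> B" using C(1) by (simp add: B_def)
  define D where "D = real (K ^ (2 * m * card (verts G))) * B"
  have "norm (central_moment (M n) (\<lambda>\<omega>. graph_trace n G \<gamma> (\<lambda>i. X n i \<omega>)) (2 * m)) \<le> D * norm (real n ^ K)" for n
  proof -
    let ?T = "{..<2 * m} \<rightarrow>\<^sub>E (verts G \<rightarrow>\<^sub>E {..<n})"
    let ?E = "\<lambda>\<Phi>. \<integral>\<omega>. (\<Prod>j<2 * m. cblock n \<Phi> j \<omega>) \<partial>M n"
    let ?S = "{\<Phi> \<in> ?T. card (\<Union>j<2 * m. \<Phi> j ` verts G) \<le> K}"
    have fin: "finite ?T" by (simp add: finite_PiE)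
    have bound: "cmod (?E \<Phi>) \<le> B" if "\<Phi> \<in> ?T" for \<Phi>
    proof -
      have mem: "block_index G \<gamma> \<Phi> ` ({..<2 * m} \<times> arcs G) \<subseteq> \<gamma> ` arcs G \<times> upper_indices n"
        "block_index G \<gamma> \<Phi> ` ({..<2 * m} \<times> arcs G) \<subseteq> I \<times> upper_indices n"
        using block_index_mem[of "{..<2 * m}" \<Phi> n, OF PiE_mem[OF that]] by simp_all
      have "cmod (?E \<Phi>) \<le> 2 ^ card {..<2 * m} * (1 + real L * C) ^ (card {..<2 * m} + 1)"
        using mem(2) C(1) C(2)[OF subsetD[OF mem(1) imageI]]
        by (intro entries.norm_expectation_prod_centred_le) (simp_all add: L_def)
      then show ?thesis by (simp add: B_def)
    qed
    have "norm (central_moment (M n) (\<lambda>\<omega>. graph_trace n G \<gamma> (\<lambda>i. X n i \<omega>)) (2 * m))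
      = cmod (\<Sum>\<Phi>\<in>?T. ?E \<Phi>)"
      by (simp only: central_moment_graph_trace[symmetric] norm_of_real real_norm_def)
    \<comment> \<open>Tuples whose images have more than \<open>K\<close> vertices in their union
      contribute 0.\<close>
    also have "(\<Sum>\<Phi>\<in>?T. ?E \<Phi>) = (\<Sum>\<Phi>\<in>?S. ?E \<Phi>)"
      using fin nonzero_cblocks_small by (intro sum.mono_neutral_right) (auto simp: K_def)
    also have "cmod \<dots> \<le> real (card ?S) * B"
      using bound by (intro order.trans[OF norm_sum] sum_bounded_above) auto
    also have "\<dots> \<le> real (K ^ (card {..<2 * m} * card (verts G)) * n ^ K) * B"
      using B m verts_nonempty
      by (intro mult_right_mono of_nat_mono card_tuples_small_union) (auto simp: lessThan_empty_iff)
    also have "\<dots> = D * norm (real n ^ K)" by (simp add: D_def)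
    finally show ?thesis .
  qed
  then show ?thesis unfolding K_def by (intro bigoI[where c = D]) auto
qed

end

section \<open>Mixed second moments of two terms\<close>

context wigner_graph
begin

text \<open>Numbering the blocks 0 and 1 conjugates exactly the second one, so the vanishing
  criteria for blocks also apply to covariances.\<close>

lemma gterm_mult_cnj:
  assumes "\<omega> \<in> space (M n)" "s \<in> verts G \<rightarrow>\<^sub>E {..<n}" "t \<in> verts G \<rightarrow>\<^sub>E {..<n}"
  shows "gterm n s \<omega> * cnj (gterm n t \<omega>) = block n (\<lambda>j. if j = 0 then s else t) {0, 1} \<omega>"
proof -
  let ?\<Phi> = "\<lambda>j. if j = (0::nat) then s else t"
  have "block n ?\<Phi> {0, 1} \<omega> = (\<Prod>j\<in>{0, 1}. block n ?\<Phi> {j} \<omega>)"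
    by (rule entries.prod_monomial_blocks[symmetric])
  also have "\<dots> = block n ?\<Phi> {0} \<omega> * block n ?\<Phi> {1} \<omega>" by simp
  also have "\<dots> = twist (odd (0::nat)) (gterm n (?\<Phi> 0) \<omega>) * twist (odd (1::nat)) (gterm n (?\<Phi> 1) \<omega>)"
    using assms twist_gterm[of \<omega> n ?\<Phi> 0] twist_gterm[of \<omega> n ?\<Phi> 1] by simp
  finally show ?thesis by (simp add: twist_def)
qed

lemma expectation_gterm_mult_cnj:
  assumes "s \<in> verts G \<rightarrow>\<^sub>E {..<n}" "t \<in> verts G \<rightarrow>\<^sub>E {..<n}"
  shows "(\<integral>\<omega>. gterm n s \<omega> * cnj (gterm n t \<omega>) \<partial>M n) =
      (\<integral>\<omega>. block n (\<lambda>j. if j = 0 then s else t) {0, 1} \<omega> \<partial>M n)"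
    and "integrable (M n) (\<lambda>\<omega>. gterm n s \<omega> * cnj (gterm n t \<omega>))"
proof -
  note eq = gterm_mult_cnj[OF _ assms]
  show "(\<integral>\<omega>. gterm n s \<omega> * cnj (gterm n t \<omega>) \<partial>M n) =
      (\<integral>\<omega>. block n (\<lambda>j. if j = 0 then s else t) {0, 1} \<omega> \<partial>M n)"
    by (rule Bochner_Integration.integral_cong[OF refl eq])
  have "integrable (M n) (block n (\<lambda>j. if j = 0 then s else t) {0, 1})"
    using assms by (intro block_integrable) auto
  then show "integrable (M n) (\<lambda>\<omega>. gterm n s \<omega> * cnj (gterm n t \<omega>))"
    by (rule iffD2[OF Bochner_Integration.integrable_cong[OF refl eq], rotated])
qed

end

subsection \<open>Tightness\<close>

text \<open>The arcs 0 and 1 run from the leaves 1 and 2 into the centre 0. With a single label, the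
  trace is the sum over all rows of the squared row sum.\<close>

definition star :: "(nat, nat) pre_digraph" where
  "star = \<lparr>verts = {0, 1, 2}, arcs = {0, 1}, tail = Suc, head = (\<lambda>_. 0)\<rparr>"

lemma star_simps [simp]:
  "verts star = {0, 1, 2}" "arcs star = {0, 1}" "tail star = Suc" "head star = (\<lambda>_. 0)"
  by (simp_all add: star_def)

lemma card_non_loops_star: "card (non_loops star) = 2"
proof -
  have "non_loops star = {0, 1}" by (auto simp: non_loops_def)
  then show ?thesis by simp
qed

lemma test_graph_star:
  assumes "i \<in> I"
  shows "test_graph I star (\<lambda>_. i)"
proof -
  interpret fin_digraph star by standard auto
  interpret S: pair_wf_digraph "mk_symmetric star" by (rule wellformed_mk_symmetric)
  let ?S = "with_proj (mk_symmetric star)"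
  have "0 \<rightarrow>\<^sup>*\<^bsub>?S\<^esub> u" "u \<rightarrow>\<^sup>*\<^bsub>?S\<^esub> 0" if "u \<in> {1, 2}" for u
    using that by (auto intro!: S.reachable_adjI simp: parcs_mk_symmetric)
  moreover have "0 \<rightarrow>\<^sup>*\<^bsub>?S\<^esub> 0" by simp
  ultimately have hub: "0 \<rightarrow>\<^sup>*\<^bsub>?S\<^esub> u" "u \<rightarrow>\<^sup>*\<^bsub>?S\<^esub> 0" if "u \<in> {0, 1, 2}" for u
    using that by blast+
  have "u \<rightarrow>\<^sup>*\<^bsub>?S\<^esub> v" if "u \<in> {0, 1, 2}" "v \<in> {0, 1, 2}" for u v
    by (rule S.reachable_trans[OF hub(2)[OF that(1)] hub(1)[OF that(2)]])
  then have "Digraph_Component.connected star"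
    by (simp add: connected_def strongly_connected_def)
  then show ?thesis using assms by unfold_locales auto
qed

section \<open>Covariances and second moment for the star\<close>

context wigner_family
begin

text \<open>A nonzero covariance forces \<open>t\<close> to use both edges of \<open>s\<close>.
  These share only the centre, so \<open>t\<close> can at most exchange the leaves and cannot
  reverse an edge; the two terms then coincide, and only the variances of entries enter.\<close>

lemma star_covariance:
  fixes n i
  defines "T \<equiv> {0, 1, 2} \<rightarrow>\<^sub>E {..<n}"
    and "P \<equiv> \<lambda>\<phi> \<omega>. graph_term star (\<lambda>_. i) (\<lambda>i. X n i \<omega>) \<phi>"
  assumes i: "i \<in> I" and s: "s \<in> T" "inj_on s {0, 1, 2}" and t: "t \<in> T"
  shows star_mean: "(\<integral>\<omega>. P s \<omega> \<partial>M n) = 0"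
    and star_variance: "(\<integral>\<omega>. P s \<omega> * cnj (P s \<omega>) \<partial>M n) = 1"
    and star_covariance_cases: "(\<integral>\<omega>. P s \<omega> * cnj (P t \<omega>) \<partial>M n) = 0 \<or>
      (\<integral>\<omega>. P s \<omega> * cnj (P t \<omega>) \<partial>M n) = 1 \<and> inj_on t {0, 1, 2}"
proof -
  interpret test_graph I star "\<lambda>_. i" using i by (rule test_graph_star)
  interpret wigner_graph M I X \<beta> star "\<lambda>_. i" ..
  have mem: "s \<in> verts star \<rightarrow>\<^sub>E {..<n}" "t \<in> verts star \<rightarrow>\<^sub>E {..<n}"
    using s t by (simp_all add: T_def)
  have lt: "s 0 < n" "s 1 < n" "s 2 < n" using s(1) by (auto simp: T_def PiE_iff)
  have dist: "s 0 \<noteq> s 1" "s 0 \<noteq> s 2" "s 1 \<noteq> s 2" using s(2) by (auto simp: inj_on_def)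
  have "P s \<omega> = block n (\<lambda>_. s) {0} \<omega>" if "\<omega> \<in> space (M n)" for \<omega>
    using twist_gterm[of \<omega> n "\<lambda>_. s" 0] that mem by (simp add: P_def twist_def)
  then have "(\<integral>\<omega>. P s \<omega> \<partial>M n) = (\<integral>\<omega>. block n (\<lambda>_. s) {0} \<omega> \<partial>M n)"
    by (intro Bochner_Integration.integral_cong) auto
  also have "\<dots> = 0"
    by (rule expectation_block_eq_0[where j = 0 and e = 0])
      (use mem dist in \<open>auto simp: doubleton_eq_iff numeral_2_eq_2\<close>)
  finally show "(\<integral>\<omega>. P s \<omega> \<partial>M n) = 0" .

  let ?v = "block_index star (\<lambda>_. i) (\<lambda>_. s)" and ?c = "block_conj star (\<lambda>_. s)"
  \<comment> \<open>The two copies of the arc \<open>e\<close> carry opposite conjugation flags and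
    multiply to the squared modulus of one entry, which has expectation 1.\<close>
  have fac: "(\<integral>\<omega>. entries.monomial n ({0, 1} \<times> {e}) ?v ?c \<omega> \<partial>M n) = 1" if e: "e \<in> {0, 1}" for e
  proof -
    have "s (Suc e) < n" "s 0 \<noteq> s (Suc e)" using e lt dist by (auto simp: numeral_2_eq_2)
    then have "(\<integral>\<omega>. (cmod (entry n (entry_index i (s 0) (s (Suc e))) \<omega>))\<^sup>2 \<partial>M n) = 1"
      using i lt by (intro expectation_entry)
    moreover have "entries.monomial n ({0, 1} \<times> {e}) ?v ?c \<omega>
      = complex_of_real ((cmod (entry n (entry_index i (s 0) (s (Suc e))) \<omega>))\<^sup>2)" for \<omega>
    proof -
      have "{0, 1} \<times> {e} = {(0::nat, e), (1, e)}" by auto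
      then show ?thesis unfolding complex_norm_square
        by (simp add: entries.monomial_def block_index_def block_conj_def twist_def mult.commute)
    qed
    ultimately show ?thesis by (simp only: integral_complex_of_real of_real_1)
  qed
  have split: "{0, 1} \<times> arcs star = {0, 1} \<times> {0} \<union> {0, 1} \<times> {1}" by auto
  have "(\<integral>\<omega>. P s \<omega> * cnj (P s \<omega>) \<partial>M n) = (\<integral>\<omega>. block n (\<lambda>_. s) {0, 1} \<omega> \<partial>M n)"
    using expectation_gterm_mult_cnj(1)[OF mem(1) mem(1)] by (simp add: P_def)
  also have "\<dots> = (\<integral>\<omega>. entries.monomial n ({0, 1} \<times> {0}) ?v ?c \<omega> \<partial>M n)
      * (\<integral>\<omega>. entries.monomial n ({0, 1} \<times> {1}) ?v ?c \<omega> \<partial>M n)"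
    unfolding split
  proof (rule entries.expectation_monomial_Un)
    show "?v ` ({0, 1} \<times> {0} \<union> {0, 1} \<times> {1}) \<subseteq> I \<times> upper_indices n"
      using block_index_mem(2)[of "{0, 1}" "\<lambda>_. s" n] mem(1) unfolding split by blast
    show "?v ` ({0, 1} \<times> {0}) \<inter> ?v ` ({0, 1} \<times> {1}) = {}"
      using dist by (auto simp: block_index_def entry_index_eq_iff doubleton_eq_iff numeral_2_eq_2)
  qed auto
  also have "\<dots> = 1" using fac[of 0] fac[of 1] by simp
  finally show one: "(\<integral>\<omega>. P s \<omega> * cnj (P s \<omega>) \<partial>M n) = 1" .

  show "(\<integral>\<omega>. P s \<omega> * cnj (P t \<omega>) \<partial>M n) = 0 \<or>
      (\<integral>\<omega>. P s \<omega> * cnj (P t \<omega>) \<partial>M n) = 1 \<and> inj_on t {0, 1, 2}"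
  proof (cases "(\<integral>\<omega>. P s \<omega> * cnj (P t \<omega>) \<partial>M n) = 0")
    case False
    let ?\<Phi> = "\<lambda>j. if j = (0::nat) then s else t"
    \<comment> \<open>The two edges of \<open>s\<close> differ, so an edge of \<open>s\<close> that
      is missing in \<open>t\<close> would be a variable that occurs once.\<close>
    have match: "\<exists>f\<in>{0, 1}. {t 0, t (Suc f)} = {s 0, s (Suc e)}" if e: "e \<in> {0, 1}" for e
    proof (rule ccontr)
      assume none: "\<not> ?thesis"
      have "(\<integral>\<omega>. block n ?\<Phi> {0, 1} \<omega> \<partial>M n) = 0"
      proof (rule expectation_block_eq_0[where j = 0 and e = e])
        fix k f :: nat
        assume kf: "k \<in> {0, 1}" "f \<in> arcs star" "(k, f) \<noteq> (0, e)"
        show "{?\<Phi> k (head star f), ?\<Phi> k (tail star f)} \<noteq> {?\<Phi> 0 (head star e), ?\<Phi> 0 (tail star e)}"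
        proof (cases "k = 0")
          case True
          then have "s (Suc f) \<noteq> s (Suc e)" using kf e dist by (auto simp: numeral_2_eq_2)
          then show ?thesis using True by (simp add: doubleton_eq_iff)
        next
          case False
          then show ?thesis using none kf(2) by auto
        qed
      next
        show "?\<Phi> 0 (head star e) \<noteq> ?\<Phi> 0 (tail star e)"
          using e dist by (auto simp: numeral_2_eq_2)
      qed (use e mem in simp_all)
      then show False
        using False expectation_gterm_mult_cnj(1)[OF mem] by (simp add: P_def)
    qed
    obtain f g where f: "f \<in> {0, 1}" "{t 0, t (Suc f)} = {s 0, s 1}"
      and g: "g \<in> {0, 1}" "{t 0, t (Suc g)} = {s 0, s 2}"
      using match[of 0] match[of 1] by (auto simp: numeral_2_eq_2)
    \<comment> \<open>The vertex \<open>t 0\<close> lies on both edges of \<open>s\<close>, and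
      \<open>s 0\<close> is their only common vertex.\<close>
    have "t 0 = s 0" "t (Suc f) = s 1" "t (Suc g) = s 2"
      using f(2) g(2) dist unfolding doubleton_eq_iff by metis+
    then have cases: "t 0 = s 0" "t 1 = s 1 \<and> t 2 = s 2 \<or> t 1 = s 2 \<and> t 2 = s 1"
      using f(1) g(1) dist by (auto simp: numeral_2_eq_2)
    \<comment> \<open>Both arcs have the same label, so the term is symmetric in the two
      leaves.\<close>
    have "P \<phi> \<omega> = X n i \<omega> $$ (\<phi> 0, \<phi> 1) * X n i \<omega> $$ (\<phi> 0, \<phi> 2)" for \<phi> \<omega>
      by (simp add: P_def graph_term_def numeral_2_eq_2)
    then have "P t = P s" using cases by (intro ext) (auto simp: mult.commute)
    moreover have "inj_on t {0, 1, 2}" using cases dist by (auto simp: inj_on_def)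
    ultimately show ?thesis using one by simp
  qed simp
qed

text \<open>Split the centred trace into the injective terms \<open>A\<close> and the rest
  \<open>B\<close>. The two parts are orthogonal, so the second moment is at least that of
  \<open>A\<close>, in which every term contributes its variance 1 and no covariance is
  negative.\<close>

lemma star_second_moment:
  fixes n i
  assumes i: "i \<in> I"
  defines "Z \<equiv> \<lambda>\<omega>. graph_trace n star (\<lambda>_. i) (\<lambda>i. X n i \<omega>) -
    (\<integral>\<omega>'. graph_trace n star (\<lambda>_. i) (\<lambda>i. X n i \<omega>') \<partial>M n)"
  shows "real (card {s \<in> {0, 1, 2::nat} \<rightarrow>\<^sub>E {..<n}. inj_on s {0, 1, 2}}) \<le> (\<integral>\<omega>. (cmod (Z \<omega>))\<^sup>2 \<partial>M n)"
proof -
  interpret test_graph I star "\<lambda>_. i" using i by (rule test_graph_star)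
  interpret wigner_graph M I X \<beta> star "\<lambda>_. i" ..
  define T where "T = ({0, 1, 2::nat} \<rightarrow>\<^sub>E {..<n})"
  define J where "J = {s \<in> T. inj_on s {0, 1, 2}}"
  have finT: "finite T" by (simp add: T_def finite_PiE)
  have finJ: "finite J" using finT by (simp add: J_def)
  have T_eq: "T = (verts star \<rightarrow>\<^sub>E {..<n})" by (simp add: T_def)
  define c where "c s t = (\<integral>\<omega>. gterm n s \<omega> * cnj (gterm n t \<omega>) \<partial>M n)" for s t
  define \<mu> where "\<mu> t = (\<integral>\<omega>. gterm n t \<omega> \<partial>M n)" for t
  note cov = star_covariance[OF i, of _ n, folded T_def]
  have \<mu>J: "\<mu> s = 0" if "s \<in> J" for s using cov(1)[of s s] that by (simp add: J_def \<mu>_def)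
  have hb: "has_bochner_integral (M n) (\<lambda>\<omega>. gterm n s \<omega> * cnj (gterm n t \<omega>)) (c s t)"
    if "s \<in> T" "t \<in> T" for s t
    using expectation_gterm_mult_cnj(2)[of s n t] that unfolding T_eq c_def
    by (intro has_bochner_integral_integrable)
  \<comment> \<open>Terms outside \<open>J\<close> may have nonzero mean, but subtracting it does
    not matter, as the terms of \<open>J\<close> are centred.\<close>
  have hb0: "has_bochner_integral (M n) (\<lambda>\<omega>. gterm n s \<omega> * cnj (gterm n t \<omega> - \<mu> t)) 0"
    if "s \<in> J" "t \<in> T - J" for s t
  proof -
    have "c s t = 0" using cov(3)[of s t] that by (auto simp: J_def c_def)
    then have "has_bochner_integral (M n) (\<lambda>\<omega>. gterm n s \<omega> * cnj (gterm n t \<omega>)) 0"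
      using hb[of s t] that by (simp add: J_def)
    moreover have "has_bochner_integral (M n) (gterm n s) 0"
      using has_bochner_integral_integrable[OF gterm_integrable[of s n]] \<mu>J[of s] that
      by (simp add: J_def T_eq \<mu>_def)
    then have "has_bochner_integral (M n) (\<lambda>\<omega>. gterm n s \<omega> * cnj (\<mu> t)) (0 * cnj (\<mu> t))"
      by (rule has_bochner_integral_mult_left)
    ultimately have "has_bochner_integral (M n)
        (\<lambda>\<omega>. gterm n s \<omega> * cnj (gterm n t \<omega>) - gterm n s \<omega> * cnj (\<mu> t)) (0 - 0 * cnj (\<mu> t))"
      by (rule has_bochner_integral_diff)
    then show ?thesis by (simp add: right_diff_distrib)
  qed
  define A where "A \<omega> = (\<Sum>s\<in>J. gterm n s \<omega>)" for \<omega>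
  define B where "B \<omega> = (\<Sum>t\<in>T - J. gterm n t \<omega> - \<mu> t)" for \<omega>
  have Z: "Z \<omega> = A \<omega> + B \<omega>" for \<omega>
  proof -
    have "Z \<omega> = (\<Sum>t\<in>T. gterm n t \<omega> - \<mu> t)"
      unfolding Z_def centred_graph_trace T_eq \<mu>_def ..
    also have "\<dots> = (\<Sum>t\<in>T - J. gterm n t \<omega> - \<mu> t) + (\<Sum>t\<in>J. gterm n t \<omega> - \<mu> t)"
      using finT by (intro sum.subset_diff) (auto simp: J_def)
    also have "(\<Sum>t\<in>J. gterm n t \<omega> - \<mu> t) = A \<omega>"
      unfolding A_def using \<mu>J by (intro sum.cong) auto
    finally show ?thesis by (simp add: B_def)
  qed
  \<comment> \<open>The real part of \<open>F\<close> is the squared modulus of \<open>Z\<close>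
    minus that of \<open>B\<close>: both cross terms have the same real part, whence the factor
    2.\<close>
  define F where "F \<omega> = A \<omega> * cnj (A \<omega>) + 2 * (A \<omega> * cnj (B \<omega>))" for \<omega>
  have "has_bochner_integral (M n) (\<lambda>\<omega>. (\<Sum>s\<in>J. \<Sum>t\<in>J. gterm n s \<omega> * cnj (gterm n t \<omega>)) +
      2 * (\<Sum>s\<in>J. \<Sum>t\<in>T - J. gterm n s \<omega> * cnj (gterm n t \<omega> - \<mu> t)))
      ((\<Sum>s\<in>J. \<Sum>t\<in>J. c s t) + 2 * (\<Sum>s\<in>J. \<Sum>t\<in>T - J. 0))"
    by (intro has_bochner_integral_add has_bochner_integral_mult_right has_bochner_integral_sum hb hb0)
      (auto simp: J_def)
  then have F: "has_bochner_integral (M n) F (\<Sum>s\<in>J. \<Sum>t\<in>J. c s t)"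
    by (simp add: F_def[abs_def] A_def B_def cnj_sum sum_product)
  have "real (card J) = (\<Sum>s\<in>J. 1)" by simp
  \<comment> \<open>The diagonal covariances are 1, and the others are 0 or 1.\<close>
  also have "\<dots> \<le> (\<Sum>s\<in>J. \<Sum>t\<in>J. Re (c s t))"
  proof (rule sum_mono)
    fix s assume s: "s \<in> J"
    have "1 = Re (c s s)" using cov(2)[of s s] s by (simp add: J_def c_def)
    also have "\<dots> \<le> (\<Sum>t\<in>J. Re (c s t))"
    proof (rule member_le_sum[OF s _ finJ])
      fix t assume "t \<in> J - {s}"
      then show "0 \<le> Re (c s t)" using cov(3)[of s t] s by (auto simp: J_def c_def)
    qed
    finally show "1 \<le> (\<Sum>t\<in>J. Re (c s t))" .
  qed
  also have "\<dots> = Re (\<integral>\<omega>. F \<omega> \<partial>M n)"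
    using has_bochner_integral_integral_eq[OF F] by (simp add: Re_sum)
  also have "\<dots> = (\<integral>\<omega>. Re (F \<omega>) \<partial>M n)"
    using F by (simp add: has_bochner_integral_iff)
  also have "\<dots> \<le> (\<integral>\<omega>. (cmod (Z \<omega>))\<^sup>2 \<partial>M n)"
  proof (rule integral_mono)
    show "integrable (M n) (\<lambda>\<omega>. Re (F \<omega>))" using F by (simp add: has_bochner_integral_iff)
    show "integrable (M n) (\<lambda>\<omega>. (cmod (Z \<omega>))\<^sup>2)"
      using integrable_power_centred_graph_trace[of n 1] by (simp add: Z_def)
    show "Re (F \<omega>) \<le> (cmod (Z \<omega>))\<^sup>2" for \<omega>
    proof -
      have "(cmod (Z \<omega>))\<^sup>2 = Re (F \<omega>) + (cmod (B \<omega>))\<^sup>2"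
        unfolding Z F_def cmod_power2 by (simp add: power2_eq_square algebra_simps)
      then show ?thesis by simp
    qed
  qed
  finally show ?thesis by (simp add: J_def T_def)
qed

end

text \<open>Giving each vertex its own interval of length \<open>n div 3\<close> makes the choices
  independent and the map automatically injective.\<close>

lemma card_inj_triples:
  "(n div 3) ^ 3 \<le> card {s \<in> {0, 1, 2::nat} \<rightarrow>\<^sub>E {..<n}. inj_on s {0, 1, 2}}"
proof -
  define q where "q = n div 3"
  define R where "R v = {v * q..<Suc v * q}" for v
  have R: "s 0 < q" "q \<le> s 1" "s 1 < 2 * q" "2 * q \<le> s 2" "s 2 < 3 * q"
    if "s \<in> (\<Pi>\<^sub>E v\<in>{0, 1, 2}. R v)" for s
    using PiE_mem[OF that, of 0] PiE_mem[OF that, of 1] PiE_mem[OF that, of 2] by (auto simp: R_def)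
  have "(\<Pi>\<^sub>E v\<in>{0, 1, 2}. R v) \<subseteq> {s \<in> {0, 1, 2} \<rightarrow>\<^sub>E {..<n}. inj_on s {0, 1, 2}}"
  proof
    fix s assume s: "s \<in> (\<Pi>\<^sub>E v\<in>{0, 1, 2}. R v)"
    have "3 * q \<le> n" by (simp add: q_def)
    with R[OF s] s show "s \<in> {s \<in> {0, 1, 2} \<rightarrow>\<^sub>E {..<n}. inj_on s {0, 1, 2}}"
      by (auto simp: PiE_iff inj_on_def)
  qed
  then have "card (\<Pi>\<^sub>E v\<in>{0, 1, 2}. R v) \<le> card {s \<in> {0, 1, 2::nat} \<rightarrow>\<^sub>E {..<n}. inj_on s {0, 1, 2}}"
    by (rule card_mono[rotated]) (simp add: finite_PiE)
  moreover have "card (\<Pi>\<^sub>E v\<in>{0, 1, 2}. R v) = q ^ 3"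
    by (simp add: card_PiE R_def power3_eq_cube)
  ultimately show ?thesis by (simp add: q_def)
qed

text \<open>Jensen's inequality for the squared modulus of the centred trace lifts the bound on the
  second moment to order \<open>2 * m\<close>. The exponent 3 is the number of non-loops of the star
  plus 1.\<close>

lemma (in wigner_family) central_moment_star:
  assumes i: "i \<in> I" and n: "n \<ge> 4"
  shows "(real n / 6) ^ (m * 3)
    \<le> central_moment (M n) (\<lambda>\<omega>. graph_trace n star (\<lambda>_. i) (\<lambda>i. X n i \<omega>)) (2 * m)"
proof -
  interpret test_graph I star "\<lambda>_. i" using i by (rule test_graph_star)
  interpret wigner_graph M I X \<beta> star "\<lambda>_. i" ..
  define f where "f \<omega> = (cmod (graph_trace n star (\<lambda>_. i) (\<lambda>i. X n i \<omega>) -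
    (\<integral>\<omega>'. graph_trace n star (\<lambda>_. i) (\<lambda>i. X n i \<omega>') \<partial>M n)))\<^sup>2" for \<omega>
  \<comment> \<open>Since \<open>n div 3\<close> is at least \<open>(n - 2) / 3\<close>, this holds
    as soon as \<open>n\<close> is at least 4.\<close>
  have "real n / 6 \<le> real (n div 3)" using n by linarith
  then have "(real n / 6) ^ 3 \<le> real (n div 3) ^ 3" by (intro power_mono) auto
  also have "\<dots> \<le> real (card {s \<in> {0, 1, 2::nat} \<rightarrow>\<^sub>E {..<n}. inj_on s {0, 1, 2}})"
    unfolding of_nat_power[symmetric] by (rule of_nat_mono[OF card_inj_triples])
  also have "\<dots> \<le> (\<integral>\<omega>. f \<omega> \<partial>M n)"
    unfolding f_def by (rule star_second_moment[OF i])
  finally have "((real n / 6) ^ 3) ^ m \<le> (\<integral>\<omega>. f \<omega> \<partial>M n) ^ m" by (intro power_mono) auto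
  also have "\<dots> \<le> (\<integral>\<omega>. f \<omega> ^ m \<partial>M n)"
    using integrable_power_centred_graph_trace[of n 1] integrable_power_centred_graph_trace[of n m]
    by (intro entries.power_expectation_le) (auto simp: f_def power_mult)
  also have "\<dots> = central_moment (M n) (\<lambda>\<omega>. graph_trace n star (\<lambda>_. i) (\<lambda>i. X n i \<omega>)) (2 * m)"
    by (simp add: central_moment_def f_def power_mult)
  finally show ?thesis by (simp add: power_mult mult.commute[of m 3])
qed

theorem theorem3p3p2:
  fixes M :: "nat \<Rightarrow> 'a measure"
    and I :: "'i set"
    and X :: "nat \<Rightarrow> 'i \<Rightarrow> 'a \<Rightarrow> complex mat"
    and \<beta> :: "'i \<Rightarrow> complex"
    and m :: nat
  assumes "wigner_family M I X \<beta>"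
    and "I \<noteq> {}"
    and "m \<ge> 1"
  shows "(\<forall>(G :: ('v, 'e) pre_digraph) \<gamma>. test_graph I G \<gamma> \<longrightarrow>
            (\<lambda>n. central_moment (M n) (\<lambda>\<omega>. graph_trace n G \<gamma> (\<lambda>i. X n i \<omega>)) (2 * m))
              \<in> O(\<lambda>n. real n ^ (m * (card (non_loops G) + 1)))) \<and>
         (\<exists>(G :: (nat, nat) pre_digraph) \<gamma>. test_graph I G \<gamma> \<and>
            (\<lambda>n. central_moment (M n) (\<lambda>\<omega>. graph_trace n G \<gamma> (\<lambda>i. X n i \<omega>)) (2 * m))
              \<in> \<Theta>(\<lambda>n. real n ^ (m * (card (non_loops G) + 1))))"
proof (intro conjI allI impI)
  fix G :: "('v, 'e) pre_digraph" and \<gamma>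
  assume "test_graph I G \<gamma>"
  then interpret wigner_graph M I X \<beta> G \<gamma>
    using assms(1) by (simp add: wigner_graph_def)
  show "(\<lambda>n. central_moment (M n) (\<lambda>\<omega>. graph_trace n G \<gamma> (\<lambda>i. X n i \<omega>)) (2 * m))
              \<in> O(\<lambda>n. real n ^ (m * (card (non_loops G) + 1)))"
    by (rule central_moment_upper[OF assms(3)])
next
  obtain i where i: "i \<in> I" using assms(2) by blast
  interpret test_graph I star "\<lambda>_. i" using i by (rule test_graph_star)
  interpret wigner_family M I X \<beta> by (rule assms(1))
  interpret wigner_graph M I X \<beta> star "\<lambda>_. i" ..
  let ?c = "\<lambda>n. central_moment (M n) (\<lambda>\<omega>. graph_trace n star (\<lambda>_. i) (\<lambda>i. X n i \<omega>)) (2 * m)"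
  let ?g = "\<lambda>n. real n ^ (m * (card (non_loops star) + 1))"
  have "?g \<in> O(?c)"
  \<comment> \<open>The constant clears the denominator in the lower bound by the power of
    \<open>real n / 6\<close>.\<close>
  proof (rule bigoI[where c = "6 ^ (m * 3)"])
    show "eventually (\<lambda>n. norm (?g n) \<le> 6 ^ (m * 3) * norm (?c n)) at_top"
    proof (rule eventually_mono[OF eventually_ge_at_top[of 4]])
      fix n :: nat assume "4 \<le> n"
      from central_moment_star[OF i this, of m] have "real n ^ (m * 3) \<le> 6 ^ (m * 3) * ?c n"
        by (simp add: power_divide field_simps)
      also have "\<dots> \<le> 6 ^ (m * 3) * norm (?c n)" by (intro mult_left_mono) auto
      finally show "norm (?g n) \<le> 6 ^ (m * 3) * norm (?c n)"
        unfolding card_non_loops_star by simp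
    qed
  qed
  then have "?c \<in> \<Theta>(?g)"
    using central_moment_upper[OF assms(3)] by (intro bigthetaI) (auto simp: bigomega_iff_bigo)
  then show "\<exists>(G :: (nat, nat) pre_digraph) \<gamma>. test_graph I G \<gamma> \<and>
            (\<lambda>n. central_moment (M n) (\<lambda>\<omega>. graph_trace n G \<gamma> (\<lambda>i. X n i \<omega>)) (2 * m))
              \<in> \<Theta>(\<lambda>n. real n ^ (m * (card (non_loops G) + 1)))"
    using test_graph_star[OF i] by blast
qed

end
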